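(* Let $n \geq 1$. The algebraic multiplicity $m_n$ of the eigenvalue $1$ of $R_n^*$ satisfies $m_n = n - k_n$, where the sequence $(k_n)$ is defined by $k_1=0$ and $k_n = \max(k_{n-1}, \omega(n)+1)$ for $n\ge 2$. In particular, $$n - \left\lfloor \frac{1.3841\,\log n}{\log\log n}\right\rfloor - 1 \leq m_n \quad (n\ge 3), \qquad m_n \leq n - \left\lfloor \frac{\log n}{\log\log n}\right\rfloor \quad (n \geq 6).$$ Moreover, for every $n\ge 3$, $$\left| m_n - n + \frac{\log n}{\log\log n}\right| \leq \frac{2\log n}{(\log\log n)^2}.$$
   Context: $\omega(m)$ denotes the number of distinct prime factors of $m$. For positive integers $i,j$, $i \parallel j$ means $i \mid j$ and $\gcd(i,j/i)=1$. $R_n^*=(\rho_{ij})_{1\le i,j\le n}$ is the $n\times n$ matrix with $\rho_{ij}=1$ if $i \parallel j$ or $j=1$, and $\rho_{ij}=0$ otherwise. The algebraic multiplicity of the eigenvalue $1$ is its multiplicity as a root of the characteristic polynomial $\det(\lambda I_n - R_n^* )$. *)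

theory Defs
  imports Complex_Main "Jordan_Normal_Form.Char_Poly" "HOL-Computational_Algebra.Primes"
begin

definition unitary_dvd :: "nat \<Rightarrow> nat \<Rightarrow> bool" where
  "unitary_dvd i j \<longleftrightarrow> i dvd j \<and> gcd i (j div i) = 1"

definition omega :: "nat \<Rightarrow> nat" where
  "omega m = card (prime_factors m)"

text \<open>The n x n matrix R_n^*, with 1-based indices i,j shifted to 0-based.\<close>
definition Rstar :: "nat \<Rightarrow> real mat" where
  "Rstar n = mat n n (\<lambda>(i, j). if unitary_dvd (i + 1) (j + 1) \<or> j + 1 = 1 then 1 else 0)"

definition mult_one :: "nat \<Rightarrow> nat" where
  "mult_one n = order 1 (char_poly (Rstar n))"

text \<open>k_1 = 0, k_n = max(k_{n-1}, omega n + 1) for n >= 2 (k_0 is an unused dummy).\<close>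
fun kseq :: "nat \<Rightarrow> nat" where
  "kseq 0 = 0"
| "kseq (Suc 0) = 0"
| "kseq (Suc (Suc m)) = max (kseq (Suc m)) (omega (Suc (Suc m)) + 1)"

end

theory Submission
  imports Defs
begin

text \<open>Put \<open>x = \<lambda> - 1\<close>. Row reduction of \<open>\<lambda> I - R_n^*\<close> with weights that count chains of proper unitary
  divisors starting at \<open>1\<close> gives the characteristic polynomial
  \<open>x^n - (\<Sum>k \<ge> 1. s_k x^(n - 1 - k))\<close>, where \<open>s_k \<ge> 0\<close> counts the chains of length \<open>k\<close> ending in
  \<open>{2..n}\<close>. A chain ending in \<open>m\<close> has length at most \<open>\<omega>(m)\<close> and this is attained, so the order of
  vanishing at \<open>x = 0\<close> is \<open>n - 1 - max \<omega>\<close>.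

  The largest value of \<open>\<omega>\<close> up to \<open>n\<close> is governed by products of distinct primes. When a prime \<open>p\<close>
  exceeding all members of a set of primes with log-product \<open>L\<close> is added, the mean value theorem
  shows that \<open>L / ln L\<close> and \<open>L / ln L + 2 L / (ln L)^2\<close> grow by an amount that can be compared with 1
  once \<open>p\<close> is comparable with \<open>L\<close>. Hence Chebyshev's estimates suffice: \<open>\<theta>(x) \<le> x ln 4\<close> for the bounds
  from above, and \<open>x + 1 \<le> e \<theta>(x)\<close> for the bound from below. The remaining finite range is checked
  with explicit values of \<open>\<theta>\<close>; the constant 1.3841 is nearly attained by the product of the first
  nine primes.\<close>

section \<open>The characteristic polynomial\<close>

lemma unitary_dvd_self: "n > 0 \<Longrightarrow> unitary_dvd n n"
  by (simp add: unitary_dvd_def)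

text \<open>The cofactor \<open>q = j div i\<close> exceeds 1 and is coprime to \<open>i\<close>, so
  any prime of \<open>q\<close> is a prime factor of \<open>j\<close> that \<open>i\<close> lacks.
  This bounds the length of a chain ending in \<open>j\<close> by \<open>omega j\<close>.\<close>

lemma omega_less_if_unitary_dvd:
  assumes "unitary_dvd i j" "i < j"
  shows "omega i < omega j"
proof -
  from assms obtain q where q: "j = i * q"
    by (auto simp: unitary_dvd_def)
  with assms have "i > 0" by (cases i) auto
  then have cop: "coprime i q"
    using assms q by (simp add: unitary_dvd_def coprime_iff_gcd_eq_1)
  have "q > 1" using assms q by (cases q) auto
  then have "q \<noteq> 1" by simp
  then obtain p where p: "prime p" "p dvd q"
    using prime_factor_nat by blast
  have "\<not> p dvd i"
  proof
    assume "p dvd i"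
    then have "is_unit p"
      using coprime_common_divisor[OF cop _ p(2)] by simp
    with p(1) show False by simp
  qed
  then have "p \<notin> prime_factors i" "p \<in> prime_factors j"
    using p \<open>i > 0\<close> \<open>q > 1\<close> unfolding q by (auto simp: in_prime_factors_iff)
  moreover have "prime_factors i \<subseteq> prime_factors j"
    using \<open>i > 0\<close> \<open>q > 1\<close> unfolding q by (intro dvd_prime_factors) auto
  ultimately have "prime_factors i \<subset> prime_factors j" by blast
  then show ?thesis
    unfolding omega_def by (intro psubset_card_mono) auto
qed

text \<open>Dividing out the full power of one prime leaves a unitary divisor with exactly one prime
  fewer. Repeating this yields a chain of length \<open>omega j\<close>.\<close>

lemma ex_unitary_dvd_omega:
  assumes "j \<ge> 2"
  obtains i where "unitary_dvd i j" "i < j" "i \<ge> 1" "omega j = Suc (omega i)"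
proof -
  obtain p where p: "prime p" "p dvd j"
    using assms prime_factor_nat[of j] by auto
  have "j \<noteq> 0" "\<not> is_unit p"
    using assms p by auto
  then obtain i where i: "j = p ^ multiplicity p j * i" "\<not> p dvd i"
    using multiplicity_decompose'[of j p] by metis
  have "multiplicity p j > 0"
    using p assms by (simp add: prime_multiplicity_gt_zero_iff)
  then obtain e where e: "multiplicity p j = Suc e"
    by (cases "multiplicity p j") auto
  have "i > 0" using i(2) by (cases i) auto
  have cop: "coprime i (p ^ Suc e)"
    using prime_imp_coprime[OF p(1) i(2)] by (simp add: coprime_commute)
  have "unitary_dvd i j"
    using cop \<open>i > 0\<close> p unfolding unitary_dvd_def i(1)[unfolded e]
    by (simp add: coprime_iff_gcd_eq_1)
  moreover have "i < j"
  proof -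
    have "1 < p ^ Suc e" by (rule one_less_power) (use p(1) prime_gt_1_nat in auto)
    then show ?thesis unfolding i(1)[unfolded e] using \<open>i > 0\<close> by simp
  qed
  moreover have "prime_factors j = insert p (prime_factors i)"
  proof -
    have "q dvd j \<longleftrightarrow> q = p \<or> q dvd i" if "prime q" for q
    proof -
      have "q dvd j \<longleftrightarrow> q dvd p ^ Suc e \<or> q dvd i"
        using i(1) e prime_dvd_mult_iff[OF that] by metis
      also have "q dvd p ^ Suc e \<longleftrightarrow> q dvd p"
        by (rule prime_dvd_power_iff[OF that]) simp
      also have "q dvd p \<longleftrightarrow> q = p"
        using primes_dvd_imp_eq[OF that p(1)] by auto
      finally show ?thesis .
    qed
    then show ?thesis
      using p \<open>i > 0\<close> \<open>j \<noteq> 0\<close> by (auto simp: in_prime_factors_iff)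
  qed
  then have "omega j = Suc (omega i)"
    using i(2) unfolding omega_def by (simp add: in_prime_factors_iff)
  ultimately show ?thesis using that[of i] \<open>i > 0\<close> by simp
qed

text \<open>The coefficient of \<open>X ^ k\<close> in \<open>chain_poly j\<close> is the number of chains
  \<open>1 = d_0 < d_1 < ... < d_k = j\<close> in which each \<open>d_i\<close> is a unitary divisor of \<open>d_(i+1)\<close>.\<close>

fun chain_poly :: "nat \<Rightarrow> real poly" where
  "chain_poly j = (if j \<le> 1 then 1
     else [:0, 1:] * (\<Sum>i\<in>{i. unitary_dvd i j \<and> i < j}. chain_poly i))"

declare chain_poly.simps [simp del]

lemma chain_poly_1: "chain_poly (Suc 0) = 1"
  by (simp add: chain_poly.simps)

text \<open>Each step of a chain raises \<open>omega\<close> by at least one, and some chain raises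
  it by exactly one throughout, so the degree is \<open>omega j\<close>. Nonnegativity rules out
  cancellation of leading terms when these polynomials are summed.\<close>

lemma chain_poly_coeffs:
  assumes "j \<ge> 1"
  shows "(\<forall>k. coeff (chain_poly j) k \<ge> 0) \<and> (\<forall>k > omega j. coeff (chain_poly j) k = 0) \<and>
         coeff (chain_poly j) (omega j) > 0"
  using assms
proof (induction j rule: less_induct)
  case (less j)
  show ?case
  proof (cases "j = 1")
    case True
    then show ?thesis by (simp add: chain_poly_1 omega_def)
  next
    case False
    with less.prems have j: "j \<ge> 2" by simp
    let ?D = "{i. unitary_dvd i j \<and> i < j}"
    have D: "1 \<le> i" if "i \<in> ?D" for i
      using that j by (cases i) (auto simp: unitary_dvd_def)
    have rec: "coeff (chain_poly j) k = (case k of 0 \<Rightarrow> 0 | Suc k' \<Rightarrow> \<Sum>i\<in>?D. coeff (chain_poly i) k')" for k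
      using j by (subst chain_poly.simps) (simp add: coeff_pCons coeff_sum split: nat.split)
    obtain i where i: "unitary_dvd i j" "i < j" "i \<ge> 1" "omega j = Suc (omega i)"
      using ex_unitary_dvd_omega[OF j] .
    have "coeff (chain_poly j) k \<ge> 0" for k
    proof (cases k)
      case (Suc k')
      then show ?thesis unfolding rec using less.IH D by (auto intro!: sum_nonneg)
    qed (simp add: rec)
    moreover have "coeff (chain_poly j) k = 0" if "k > omega j" for k
    proof -
      obtain k' where k': "k = Suc k'" using \<open>k > omega j\<close> by (cases k) auto
      have "coeff (chain_poly d) k' = 0" if "d \<in> ?D" for d
        using less.IH[of d] D[OF that] that omega_less_if_unitary_dvd[of d j] k' \<open>k > omega j\<close> by auto
      then show ?thesis unfolding rec k' by simp
    qed
    moreover have "coeff (chain_poly j) (omega j) > 0"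
    proof -
      have "0 < (\<Sum>d\<in>?D. coeff (chain_poly d) (omega i))"
        using less.IH i D by (intro sum_pos2[of _ i]) auto
      then show ?thesis unfolding rec i(4) by simp
    qed
    ultimately show ?thesis by blast
  qed
qed

lemma chain_poly_rec_inverse:
  assumes "j \<ge> 2" "x \<noteq> 0"
  shows "x * poly (chain_poly j) (1 / x) = (\<Sum>i\<in>{i. unitary_dvd i j \<and> i < j}. poly (chain_poly i) (1 / x))"
  using assms by (subst chain_poly.simps) (simp add: poly_sum)

text \<open>Adding the multiples \<open>poly (chain_poly j) (1 / x)\<close> of the other rows to the first row of
  \<open>(1 + x) I - R_n^*\<close> clears that row up to its first entry.\<close>

lemma poly_char_poly_Rstar:
  assumes "n \<ge> 1" "x \<noteq> 0"
  shows "poly (char_poly (Rstar n)) (1 + x)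
    = x ^ (n - 1) * (x - (\<Sum>j=2..n. poly (chain_poly j) (1 / x)))"
proof -
  define y where "y j = poly (chain_poly j) (1 / x)" for j
  define M where "M = mat n n (\<lambda>(i, j). (if i = j then 1 + x else 0) - Rstar n $$ (i, j))"
  \<comment> \<open>\<open>Y\<close> is the identity with its first row replaced by the weights; it
    is unit upper triangular because \<open>y 1 = 1\<close>, so the row operation preserves the
    determinant.\<close>
  define Y where "Y = mat n n (\<lambda>(i, j). if i = 0 then y (j + 1) else if i = j then 1 else 0)"
  define B where "B = Y * M"
  have car: "Rstar n \<in> carrier_mat n n" "M \<in> carrier_mat n n" "Y \<in> carrier_mat n n" "B \<in> carrier_mat n n"
    unfolding Rstar_def M_def Y_def B_def by auto
  have "- char_matrix (Rstar n) (1 + x) = M"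
    unfolding char_matrix_def M_def using car(1) by (intro eq_matI) auto
  then have "poly (char_poly (Rstar n)) (1 + x) = det M"
    by (simp add: char_poly_matrix[OF car(1)])
  have y1: "y (Suc 0) = 1" by (simp add: y_def chain_poly_1)
  have "det Y = prod_list (diag_mat Y)"
    using car(3) by (intro det_upper_triangular) (auto simp: Y_def)
  also have "diag_mat Y = map (\<lambda>_. 1) [0..<n]"
    unfolding diag_mat_def using y1 by (auto simp: Y_def)
  finally have "det Y = 1" by (simp add: map_replicate_const)
  then have "det B = det M"
    unfolding B_def using det_mult[OF car(3,2)] by simp
  have Mij: "M $$ (i, j) = (if i = j then 1 + x else 0) - (if unitary_dvd (i + 1) (j + 1) \<or> j = 0 then 1 else 0)"
    if "i < n" "j < n" for i j
    using that by (auto simp: M_def Rstar_def)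
  have Brow: "B $$ (0, j) = (\<Sum>k<n. y (k + 1) * M $$ (k, j))" if "j < n" for j
    using that assms car unfolding B_def
    by (auto simp: Y_def scalar_prod_def lessThan_atLeast0 intro!: sum.cong)
  have Brest: "B $$ (i, j) = M $$ (i, j)" if "0 < i" "i < n" "j < n" for i j
  proof -
    have "B $$ (i, j) = (\<Sum>k<n. (if k = i then M $$ (k, j) else 0))"
      using that car unfolding B_def
      by (auto simp: Y_def scalar_prod_def lessThan_atLeast0 if_distrib[of "\<lambda>c. c * _"] sum.If_cases
          cong: if_cong)
    then show ?thesis using that by simp
  qed
  \<comment> \<open>In column \<open>j\<close> the diagonal contributes \<open>(1 + x) * y\<close>,
    and the sum over all unitary divisors is subtracted. The divisor \<open>j + 1\<close> itself
    cancels one \<open>y\<close>, and the recursion for \<open>chain_poly\<close> cancels the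
    remaining \<open>x * y\<close>.\<close>
  have B0: "B $$ (0, j) = 0" if "0 < j" "j < n" for j
  proof -
    let ?D = "{i. unitary_dvd i (Suc j) \<and> i < Suc j}"
    have "B $$ (0, j) = (\<Sum>k<n. (if k = j then (1 + x) * y (k + 1) else 0)
        - (if unitary_dvd (k + 1) (j + 1) then y (k + 1) else 0))"
      unfolding Brow[OF that(2)] using that by (intro sum.cong) (auto simp: Mij algebra_simps)
    also have "\<dots> = (1 + x) * y (Suc j) - (\<Sum>k<n. if unitary_dvd (k + 1) (j + 1) then y (k + 1) else 0)"
      using that by (simp add: sum_subtractf)
    also have "(\<Sum>k<n. if unitary_dvd (k + 1) (j + 1) then y (k + 1) else 0)
        = (\<Sum>k\<in>{k\<in>{..<n}. unitary_dvd (k + 1) (j + 1)}. y (k + 1))"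
      by (subst sum.inter_filter) auto
    also have "\<dots> = (\<Sum>i\<in>insert (Suc j) ?D. y i)"
    proof (rule sum.reindex_bij_witness[of _ "\<lambda>i. i - 1" Suc])
      fix i assume "i \<in> insert (Suc j) ?D"
      then have "unitary_dvd i (Suc j)" "i \<le> Suc j" "i \<noteq> 0"
        using unitary_dvd_self[of "Suc j"] by (auto simp: unitary_dvd_def)
      then show "i - 1 \<in> {k \<in> {..<n}. unitary_dvd (k + 1) (j + 1)}" "Suc (i - 1) = i"
        using that by auto
    next
      fix k assume "k \<in> {k \<in> {..<n}. unitary_dvd (k + 1) (j + 1)}"
      then show "Suc k \<in> insert (Suc j) ?D"
        using dvd_imp_le[of "Suc k" "Suc j"] by (auto simp: unitary_dvd_def)
    qed auto
    also have "\<dots> = y (Suc j) + (\<Sum>i\<in>?D. y i)"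
      by (subst sum.insert) auto
    also have "(\<Sum>i\<in>?D. y i) = x * y (Suc j)"
      unfolding y_def using chain_poly_rec_inverse[of "Suc j" x] that assms by simp
    finally show ?thesis by (simp add: algebra_simps)
  qed
  \<comment> \<open>The first column of \<open>R_n^*\<close> consists of ones, so every weight
    enters here with coefficient -1, except that row 0 gives \<open>1 + x - 1 = x\<close>.\<close>
  have B00: "B $$ (0, 0) = x - (\<Sum>j=2..n. y j)"
  proof -
    have "B $$ (0, 0) = (\<Sum>k<n. (if k = 0 then x else - y (Suc k)))"
      using assms by (subst Brow) (auto intro!: sum.cong simp: Mij y1)
    also have "{..<n} = insert 0 {1..<n}" using assms by auto
    also have "(\<Sum>k\<in>insert 0 {1..<n}. (if k = 0 then x else - y (Suc k))) = x - (\<Sum>k=1..<n. y (Suc k))"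
      by (simp add: sum_negf)
    also have "(\<Sum>k=1..<n. y (Suc k)) = (\<Sum>j=2..n. y j)"
      by (rule sum.reindex_bij_witness[of _ "\<lambda>i. i - 1" Suc]) auto
    finally show ?thesis .
  qed
  have "det B = (\<Sum>j<n. B $$ (0, j) * cofactor B 0 j)"
    using assms by (intro laplace_expansion_row[OF car(4)]) auto
  also have "\<dots> = (\<Sum>j\<in>{0}. B $$ (0, j) * cofactor B 0 j)"
    using assms B0 by (intro sum.mono_neutral_right) auto
  also have "\<dots> = B $$ (0, 0) * det (mat_delete B 0 0)"
    by (simp add: cofactor_def)
  \<comment> \<open>Deleting the first column removes the extra ones. What is left records
    divisibility only, hence is upper triangular with diagonal entries
    \<open>1 + x - 1\<close>.\<close>
  also have "det (mat_delete B 0 0) = x ^ (n - 1)"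
  proof -
    have dim: "mat_delete B 0 0 \<in> carrier_mat (n - 1) (n - 1)"
      using car(4) mat_delete_carrier by blast
    have ent: "mat_delete B 0 0 $$ (i, j) = M $$ (Suc i, Suc j)" if "i < n - 1" "j < n - 1" for i j
      using that car Brest[of "Suc i" "Suc j"] by (auto simp: mat_delete_def)
    have "det (mat_delete B 0 0) = prod_list (diag_mat (mat_delete B 0 0))"
    proof (intro det_upper_triangular[OF _ dim] upper_triangularI)
      fix i j assume "j < i" "i < dim_row (mat_delete B 0 0)"
      then show "mat_delete B 0 0 $$ (i, j) = 0"
        using dim dvd_imp_le[of "i + 2" "j + 2"] by (auto simp: ent Mij unitary_dvd_def)
    qed
    also have "diag_mat (mat_delete B 0 0) = map (\<lambda>_. x) [0..<n - 1]"
      unfolding diag_mat_def using dim by (auto simp: ent Mij unitary_dvd_self)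
    finally show ?thesis by (simp add: map_replicate_const)
  qed
  finally show ?thesis
    using \<open>det B = det M\<close> \<open>poly _ _ = det M\<close> B00 by (simp add: y_def)
qed

section \<open>The sequence \<open>kseq\<close> and the order of the root 1\<close>

lemma omega_less: "m \<ge> 1 \<Longrightarrow> omega m < m"
proof -
  assume m: "m \<ge> 1"
  have "prime_factors m \<subseteq> {2..m}"
    using m by (auto simp: in_prime_factors_iff prime_ge_2_nat dvd_imp_le)
  then have "omega m \<le> card {2..m}" unfolding omega_def by (intro card_mono) auto
  with m show ?thesis by simp
qed

text \<open>Together with \<open>kseq_eq_omega\<close> this identifies \<open>kseq n\<close>, for
  \<open>n \<ge> 2\<close>, as one more than the maximum of \<open>omega\<close> on
  \<open>{2..n}\<close>.\<close>

lemma omega_le_kseq: "2 \<le> m \<Longrightarrow> m \<le> n \<Longrightarrow> omega m + 1 \<le> kseq n"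
proof (induction n rule: kseq.induct)
  case (3 k)
  then show ?case by (cases "m = Suc (Suc k)") auto
qed auto

lemma kseq_eq_omega:
  assumes "n \<ge> 2"
  obtains m where "2 \<le> m" "m \<le> n" "kseq n = omega m + 1"
proof -
  have "\<exists>m. 2 \<le> m \<and> m \<le> n \<and> kseq n = omega m + 1"
    using assms
  proof (induction n rule: dec_induct)
    case base
    have "kseq 2 = omega 2 + 1" by (simp add: numeral_2_eq_2)
    then show ?case by blast
  next
    case (step n)
    then obtain k where k: "n = Suc k" by (cases n) auto
    show ?case
    proof (cases "kseq n \<le> omega (Suc n) + 1")
      case True
      then show ?thesis using step k by (intro exI[of _ "Suc n"]) auto
    next
      case False
      then show ?thesis using step k by (auto simp: max_def)
    qed
  qed
  with that show ?thesis by blast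
qed

text \<open>Ensures that the natural-number subtraction \<open>n - kseq n\<close> does not
  truncate.\<close>

lemma kseq_le: "kseq n \<le> n"
proof (cases "n \<ge> 2")
  case True
  then obtain m where "2 \<le> m" "m \<le> n" "kseq n = omega m + 1" by (rule kseq_eq_omega)
  with omega_less[of m] show ?thesis by simp
next
  case False
  then have "n = 0 \<or> n = Suc 0" by auto
  then show ?thesis by auto
qed

text \<open>Multiplying by \<open>X - a\<close> makes the two sides agree at \<open>a\<close> as
  well. The determinant formula involves \<open>1 / x\<close> and so is available only away from the
  point 1.\<close>

lemma poly_eqI_punctured:
  fixes p q :: "real poly"
  assumes "\<And>z. z \<noteq> a \<Longrightarrow> poly p z = poly q z"
  shows "p = q"
proof -
  have "poly ([:-a, 1:] * p) z = poly ([:-a, 1:] * q) z" for z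
    using assms[of z] by (cases "z = a") (auto simp: algebra_simps)
  then have "[:-a, 1:] * p = [:-a, 1:] * q"
    by (intro iffD1[OF poly_eq_poly_eq_iff] ext)
  then show ?thesis
    by (subst (asm) mult_cancel_left) simp
qed

text \<open>Let \<open>K\<close> be the largest \<open>omega\<close> on \<open>{2..n}\<close> and
  \<open>S\<close> the sum of the chain polynomials, of degree \<open>K\<close>. Then
  \<open>x^(n-1) * (x - S(1/x))\<close> equals \<open>x^(n-1-K)\<close> times \<open>x^(K+1)\<close>
  minus the reversal of \<open>S\<close>; at \<open>x = 0\<close> the second factor is minus the
  leading coefficient of \<open>S\<close>, which is nonzero.\<close>

lemma mult_one_eq:
  assumes "n \<ge> 1"
  shows "mult_one n = n - kseq n"
proof (cases "n = 1")
  case True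
  have "poly (char_poly (Rstar 1)) z = poly [:-1, 1:] z" if "z \<noteq> 1" for z
    using poly_char_poly_Rstar[of 1 "z - 1"] that by simp
  then have "char_poly (Rstar 1) = [:-1, 1:]"
    by (rule poly_eqI_punctured)
  then show ?thesis
    using True order_power_n_n[of 1 1] by (simp add: mult_one_def)
next
  case False
  with assms have n: "n \<ge> 2" by simp
  obtain m where m: "2 \<le> m" "m \<le> n" "kseq n = omega m + 1"
    by (rule kseq_eq_omega[OF n])
  define K where "K = omega m"
  define S where "S = (\<Sum>j=2..n. chain_poly j)"
  have K: "K + 1 \<le> n" using kseq_le[of n] m(3) by (simp add: K_def)
  have "coeff S k = 0" if "k > K" for k
  proof -
    have "omega j \<le> K" if "j \<in> {2..n}" for j
      using omega_le_kseq[of j n] that m(3) by (simp add: K_def)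
    then have "coeff (chain_poly j) k = 0" if "j \<in> {2..n}" for j
      using that \<open>k > K\<close> chain_poly_coeffs[of j] le_less_trans[of "omega j" K k] by auto
    then show ?thesis
      unfolding S_def coeff_sum by simp
  qed
  moreover have lc: "coeff S K > 0"
    unfolding S_def coeff_sum K_def
    using chain_poly_coeffs m by (intro sum_pos2[of _ m]) auto
  ultimately have deg: "degree S = K"
    by (intro antisym degree_le le_degree) auto
  define Q where "Q = monom 1 (K + 1) - reflect_poly S"
  define T where "T = [:-1, 1:] ^ (n - kseq n) * (Q \<circ>\<^sub>p [:-1, 1:])"
  have eq: "poly (char_poly (Rstar n)) z = poly T z" if "z \<noteq> 1" for z
  proof -
    define x where "x = z - 1"
    have x: "x \<noteq> 0" using that by (simp add: x_def)
    have e: "n - 1 = (n - kseq n) + K" using K m(3) by (simp add: K_def)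
    have "poly (char_poly (Rstar n)) z = x ^ (n - 1) * (x - poly S (1 / x))"
      using poly_char_poly_Rstar[of n x] n x by (simp add: x_def S_def poly_sum)
    also have "\<dots> = x ^ (n - kseq n) * (x ^ (K + 1) - x ^ K * poly S (1 / x))"
      unfolding e by (simp add: power_add algebra_simps)
    also have "x ^ K * poly S (1 / x) = poly (reflect_poly S) x"
      using x by (simp add: poly_reflect_poly_nz deg inverse_eq_divide)
    finally show ?thesis
      by (simp add: T_def Q_def poly_pcompose poly_monom x_def)
  qed
  then have cp: "char_poly (Rstar n) = T"
    by (rule poly_eqI_punctured)
  have "poly (Q \<circ>\<^sub>p [:-1, 1:]) 1 \<noteq> 0"
    using lc deg by (simp add: Q_def poly_pcompose poly_monom poly_0_coeff_0)
  then have "order 1 T = n - kseq n"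
    unfolding T_def by (subst order_mult) (auto simp: order_power_n_n order_0I)
  with cp show ?thesis by (simp add: mult_one_def)
qed

section \<open>Chebyshev bounds\<close>

definition primes_upto :: "nat \<Rightarrow> nat set" where
  "primes_upto n = {p. prime p \<and> p \<le> n}"

definition theta :: "nat \<Rightarrow> real" where
  "theta n = (\<Sum>p\<in>primes_upto n. ln (real p))"

lemma finite_primes_upto [simp]: "finite (primes_upto n)"
  by (rule finite_subset[of _ "{..n}"]) (auto simp: primes_upto_def)

lemma primes_upto_Suc:
  "primes_upto (Suc n) = (if prime (Suc n) then insert (Suc n) (primes_upto n) else primes_upto n)"
  by (auto simp: primes_upto_def le_Suc_eq)

lemma theta_Suc: "theta (Suc n) = (if prime (Suc n) then ln (real (Suc n)) + theta n else theta n)"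
proof -
  have "Suc n \<notin> primes_upto n" by (simp add: primes_upto_def)
  then show ?thesis by (simp add: theta_def primes_upto_Suc)
qed

lemma ln_prime_nonneg: "prime p \<Longrightarrow> 0 \<le> ln (real p)"
  using prime_ge_1_nat[of p] by simp

lemma theta_mono: "m \<le> n \<Longrightarrow> theta m \<le> theta n"
  unfolding theta_def by (intro sum_mono2) (auto simp: primes_upto_def ln_prime_nonneg)

lemma sum_ln_eq_ln_prod:
  fixes S :: "nat set"
  assumes "\<And>p. p \<in> S \<Longrightarrow> p > 0"
  shows "(\<Sum>p\<in>S. ln (real p)) = ln (real (\<Prod>S))"
proof -
  have "ln (real (\<Prod>S)) = ln (\<Prod>p\<in>S. real p)" by simp
  also have "\<dots> = (\<Sum>p\<in>S. ln (real p))"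
    using assms by (cases "finite S") (force intro!: ln_prod)+
  finally show ?thesis by simp
qed

lemma prod_primes_dvd:
  fixes S :: "nat set"
  assumes "finite S" "\<And>p. p \<in> S \<Longrightarrow> prime p \<and> p dvd k"
  shows "\<Prod>S dvd k"
  using assms
proof (induction S)
  case (insert p S)
  have "coprime p (\<Prod>S)"
    using insert.hyps insert.prems by (intro prod_coprime_right) (auto intro!: primes_coprime)
  with insert show ?case by (auto intro!: divides_mult)
qed auto

section \<open>Upper bound for \<open>theta\<close>\<close>

text \<open>Row \<open>2 * m + 1\<close> of Pascal's triangle sums to \<open>2 * 4 ^ m\<close> and
  contains this coefficient twice.\<close>

lemma binomial_odd_central_le: "(2 * m + 1) choose m \<le> 4 ^ m"
proof -
  have "((2 * m + 1) choose m) + ((2 * m + 1) choose (m + 1)) = (\<Sum>k\<in>{m, m + 1}. (2 * m + 1) choose k)"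
    by simp
  also have "\<dots> \<le> (\<Sum>k\<le>2 * m + 1. (2 * m + 1) choose k)"
    by (intro sum_mono2) auto
  also have "\<dots> = 2 * 4 ^ m"
    by (simp only: choose_row_sum power_add power_mult) simp
  finally show ?thesis
    using binomial_symmetric[of m "2 * m + 1"] by simp
qed

lemma theta_odd_step: "theta (2 * m + 1) \<le> theta (m + 1) + real m * ln 4"
proof -
  let ?S = "{p. prime p \<and> m + 1 < p \<and> p \<le> 2 * m + 1}"
  have fin: "finite ?S" by (rule finite_subset[of _ "{..2 * m + 1}"]) auto
  have split: "primes_upto (2 * m + 1) = primes_upto (m + 1) \<union> ?S" "primes_upto (m + 1) \<inter> ?S = {}"
    by (auto simp: primes_upto_def)
  have "theta (2 * m + 1) = theta (m + 1) + (\<Sum>p\<in>?S. ln (real p))"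
    unfolding theta_def split(1) by (rule sum.union_disjoint[OF _ fin split(2)]) simp
  moreover have "(\<Sum>p\<in>?S. ln (real p)) = ln (real (\<Prod>?S))"
    by (rule sum_ln_eq_ln_prod) (simp add: prime_gt_0_nat)
  moreover have "\<Prod>?S dvd ((2 * m + 1) choose m)"
  proof (rule prod_primes_dvd[OF fin])
    \<comment> \<open>Such a prime divides \<open>(2m+1)!\<close> but neither \<open>m!\<close> nor
      \<open>(m+1)!\<close>, so it must divide the binomial coefficient.\<close>
    fix p assume p: "p \<in> ?S"
    then have "p dvd fact (2 * m + 1)" by (simp add: prime_dvd_fact_iff del: fact_Suc)
    also have "fact (2 * m + 1) = fact m * fact (m + 1) * ((2 * m + 1) choose m)"
      using binomial_fact_lemma[of m "2 * m + 1"] by simp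
    finally show "prime p \<and> p dvd ((2 * m + 1) choose m)"
      using p by (simp add: prime_dvd_mult_iff prime_dvd_fact_iff del: fact_Suc)
  qed
  then have "\<Prod>?S \<le> 4 ^ m"
    using binomial_odd_central_le[of m] by (auto dest!: dvd_imp_le)
  then have "real (\<Prod>?S) \<le> 4 ^ m"
    using of_nat_mono[where 'a = real, of "\<Prod>?S" "4 ^ m"] by simp
  moreover have "0 < \<Prod>?S"
    by (rule prod_pos) (simp add: prime_gt_0_nat)
  ultimately have "ln (real (\<Prod>?S)) \<le> ln (4 ^ m)"
    by (intro ln_mono) (simp_all del: of_nat_prod)
  with \<open>theta (2 * m + 1) = theta (m + 1) + (\<Sum>p\<in>?S. ln (real p))\<close>
    \<open>(\<Sum>p\<in>?S. ln (real p)) = ln (real (\<Prod>?S))\<close>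
  show ?thesis by (simp add: ln_realpow)
qed

text \<open>For odd \<open>n = 2m + 1\<close> the bounds for \<open>m + 1\<close> and for the primes
  in between add up to exactly \<open>(2m + 1) * ln 4\<close>. An even \<open>n > 2\<close> is not
  prime, so \<open>theta\<close> does not change there.\<close>

lemma theta_le: "theta n \<le> real n * ln 4"
proof (induction n rule: less_induct)
  case (less n)
  consider "n \<le> 1" | "n = 2" | m where "n = 2 * m + 1" "m \<ge> 1" | m where "n = 2 * m" "m \<ge> 2"
  proof (cases "even n")
    case True
    then obtain m where m: "n = 2 * m" by blast
    show ?thesis using that(1,2) that(4)[OF m] m by (cases "m \<ge> 2"; cases "m = 0") auto
  next
    case False
    then obtain m where m: "n = 2 * m + 1" by (auto elim: oddE)
    show ?thesis using that(1) that(3)[OF m] m by (cases "m \<ge> 1") auto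
  qed
  then show ?case
  proof cases
    case 1
    then have "primes_upto n = {}"
      by (auto simp: primes_upto_def dest: prime_gt_1_nat)
    then show ?thesis by (simp add: theta_def)
  next
    case 2
    then have "primes_upto n = {2}"
      by (auto simp: primes_upto_def dest: prime_ge_2_nat)
    moreover have "ln 2 \<le> 2 * ln (4 :: real)"
      using ln_mono[of 2 "4 :: real"] ln_ge_zero[of "4 :: real"] by linarith
    ultimately show ?thesis using 2 by (simp add: theta_def)
  next
    case (3 m)
    then have "theta (m + 1) \<le> real (m + 1) * ln 4" by (intro less) auto
    with theta_odd_step[of m] 3 show ?thesis by (simp add: algebra_simps)
  next
    case (4 m)
    then have "n \<noteq> 0" by simp
    then obtain k where k: "n = Suc k" using not0_implies_Suc by blast
    have "\<not> prime (2 * m)"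
      using 4 prime_product[of 2 m] by auto
    then have "\<not> prime (Suc k)" using 4(1) k by simp
    then have "theta n = theta k" using k by (simp add: theta_Suc)
    also have "\<dots> \<le> real k * ln 4" using k by (intro less) auto
    also have "\<dots> \<le> real n * ln 4" using k by (intro mult_right_mono) auto
    finally show ?thesis .
  qed
qed

section \<open>Lower bound for \<open>theta\<close> through the least common multiple of
  \<open>1, ..., n\<close>\<close>

text \<open>The reciprocals \<open>1 / (m * (n choose m))\<close> form the Leibniz harmonic triangle.\<close>

lemma Lcm_div_leibniz_Ints:
  assumes "1 \<le> m" "m \<le> n"
  shows "real (Lcm {1..n}) / (real m * real (n choose m)) \<in> \<int>"
  using assms
proof (induction m arbitrary: n rule: nat_induct_at_least)
  case base
  then have "n dvd Lcm {1..n}" by (intro dvd_Lcm) auto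
  then show ?case using base by (auto simp: real_of_nat_div[symmetric])
next
  case (Suc m n)
  define d where "d = real (Lcm {1..n})"
  obtain k where k: "n = Suc k" using Suc.prems by (cases n) auto
  have mk: "m \<le> k" "1 \<le> m" using Suc k by auto
  have "Lcm {1..k} dvd Lcm {1..n}"
    using k by (intro Lcm_subset) auto
  then obtain c where c: "Lcm {1..n} = Lcm {1..k} * c" by (elim dvdE)
  have "real c * (real (Lcm {1..k}) / (real m * real (k choose m))) \<in> \<int>"
    using Suc.IH[of k] mk by (intro Ints_mult) auto
  then have 1: "d / (real m * real (k choose m)) \<in> \<int>"
    unfolding d_def c by (simp add: mult.commute)
  have 2: "d / (real m * real (n choose m)) \<in> \<int>"
    unfolding d_def using Suc.prems mk by (intro Suc.IH) auto
  have pos: "real (n choose m) > 0" "real m > 0" "real (n - m) > 0"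
    using mk k by auto
  have e2: "real n * real (k choose m) = real (n - m) * real (n choose m)"
    using binomial_absorb_comp[of n m] k by (simp only: diff_Suc_1 flip: of_nat_mult)
  have "Suc m * (n choose Suc m) = (n - m) * (n choose m)"
    unfolding binomial_absorption binomial_absorb_comp ..
  then have e1: "real (Suc m) * real (n choose Suc m) = real (n - m) * real (n choose m)"
    by (simp only: flip: of_nat_mult)
  have e3: "real (k choose m) = real (n - m) * real (n choose m) / real n"
    using e2 k by (simp add: field_simps)
  have e4: "real n = real (n - m) + real m" using mk k by (simp add: of_nat_diff)
  \<comment> \<open>The recurrence of the triangle: the entry for \<open>(n, m + 1)\<close> is the
    difference of the entries for \<open>(n - 1, m)\<close> and \<open>(n, m)\<close>, both of which
    become integers after multiplication by the least common multiple.\<close>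
  have aux: "d / (a * (b * C / (b + a))) - d / (a * C) = d / (b * C)"
    if "a > 0" "b > 0" "C > 0" for a b C :: real
    using that by (simp add: field_simps)
  have "d / (real m * real (k choose m)) - d / (real m * real (n choose m))
      = d / (real (n - m) * real (n choose m))"
    unfolding e3 e4 by (rule aux) (use pos in auto)
  then have "d / (real (Suc m) * real (n choose Suc m)) \<in> \<int>"
    unfolding e1 using Ints_diff[OF 1 2] by simp
  then show ?case by (simp add: d_def)
qed

text \<open>With \<open>m = n div 2\<close>, the positive number
  \<open>Lcm {1..2 * m} / (m * (2 * m choose m))\<close> is an integer, hence at least 1, and
  \<open>m * (2 * m choose m)\<close> is at least \<open>4 ^ m / 2\<close>. One factor 2 is lost to
  that half and possibly one to the parity of \<open>n\<close>.\<close>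

lemma Lcm_ge_two_power:
  assumes "n \<ge> 2"
  shows "2 ^ (n - 2) \<le> real (Lcm {1..n})"
proof -
  define m where "m = n div 2"
  have m: "m \<ge> 1" "2 * m \<le> n" "n \<le> 2 * m + 1" using assms by (auto simp: m_def)
  have "Lcm {1..n} \<noteq> 0"
    by (subst Lcm_0_iff) auto
  then have pos: "0 < real (Lcm {1..2 * m})"
    using Lcm_subset[of "{1..2 * m}" "{1..n}"] m by (auto intro!: Nat.gr0I)
  have "real (Lcm {1..2 * m}) / (real m * real ((2 * m) choose m)) \<in> \<int>"
    using m by (intro Lcm_div_leibniz_Ints) auto
  moreover have C: "0 < real m * real ((2 * m) choose m)" using m by simp
  then have "0 < real (Lcm {1..2 * m}) / (real m * real ((2 * m) choose m))"
    using pos by simp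
  ultimately have "1 \<le> real (Lcm {1..2 * m}) / (real m * real ((2 * m) choose m))"
    using Ints_nonzero_abs_ge1[of "real (Lcm {1..2 * m}) / (real m * real ((2 * m) choose m))"] by linarith
  then have "real m * real ((2 * m) choose m) \<le> real (Lcm {1..2 * m})"
    using C by (simp add: field_simps)
  moreover have "4 ^ m / 2 \<le> real m * real ((2 * m) choose m)"
    using central_binomial_lower_bound[of m] m by (simp add: field_simps)
  moreover have "Lcm {1..2 * m} \<le> Lcm {1..n}"
    using \<open>Lcm {1..n} \<noteq> 0\<close> m by (intro dvd_imp_le Lcm_subset) (auto intro: Nat.gr0I)
  then have "real (Lcm {1..2 * m}) \<le> real (Lcm {1..n})" by simp
  moreover have "2 ^ (n - 2) \<le> (4 ^ m / 2 :: real)"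
  proof -
    have "(2::real) ^ (n - 2) \<le> 2 ^ (2 * m - 1)"
      using m by (intro power_increasing) auto
    also have "\<dots> = 2 ^ (2 * m) / 2" using m by (simp add: power_diff)
    also have "(2::real) ^ (2 * m) = 4 ^ m" by (simp add: power_mult)
    finally show ?thesis .
  qed
  ultimately show ?thesis by linarith
qed

text \<open>A prime enters the least common multiple with a power not exceeding \<open>n\<close>.
  The exponent is above 1 only if \<open>p\<^sup>2 \<le> n\<close>, and for those few primes an
  additional factor \<open>n\<close> pays for it.\<close>

lemma Lcm_le_prod_primes:
  assumes "n \<ge> 1"
  shows "Lcm {1..n} \<le> \<Prod>(primes_upto n) * n ^ card {p. prime p \<and> p\<^sup>2 \<le> n}"
proof -
  define e where "e p = Max (multiplicity p ` {1..n})" for p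
  have e_ge: "multiplicity p k \<le> e p" if "k \<in> {1..n}" for p k
    unfolding e_def using that by (intro Max_ge) auto
  have e_le: "p ^ e p \<le> n" if "prime p" for p
  proof -
    have "e p \<in> multiplicity p ` {1..n}"
      unfolding e_def using assms by (intro Max_in) auto
    then obtain k where k: "k \<in> {1..n}" "e p = multiplicity p k" by auto
    then have "p ^ e p dvd k" by (simp add: multiplicity_dvd)
    then show ?thesis using k by (auto dest!: dvd_imp_le)
  qed
  have "Lcm {1..n} dvd (\<Prod>p\<in>primes_upto n. p ^ e p)"
  proof (rule Lcm_least)
    fix k assume k: "k \<in> {1..n}"
    then have "k = (\<Prod>p\<in>prime_factors k. p ^ multiplicity p k)"
      by (simp add: prime_factorization_nat)
    also have "\<dots> dvd (\<Prod>p\<in>prime_factors k. p ^ e p)"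
      using e_ge[OF k] by (intro prod_dvd_prod le_imp_power_dvd) auto
    also have "\<dots> dvd (\<Prod>p\<in>primes_upto n. p ^ e p)"
      using k by (intro prod_dvd_prod_subset) (auto simp: primes_upto_def in_prime_factors_iff dest!: dvd_imp_le)
    finally show "k dvd (\<Prod>p\<in>primes_upto n. p ^ e p)" .
  qed
  moreover have "0 < (\<Prod>p\<in>primes_upto n. p ^ e p)"
    by (intro prod_pos) (auto simp: primes_upto_def prime_gt_0_nat)
  ultimately have "Lcm {1..n} \<le> (\<Prod>p\<in>primes_upto n. p ^ e p)" by (intro dvd_imp_le)
  also have "\<dots> \<le> (\<Prod>p\<in>primes_upto n. p * (if p\<^sup>2 \<le> n then n else 1))"
  proof (intro prod_mono conjI)
    fix p assume "p \<in> primes_upto n"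
    then have p: "prime p" by (simp add: primes_upto_def)
    then have "p \<ge> 1" by (rule prime_ge_1_nat)
    show "p ^ e p \<le> p * (if p\<^sup>2 \<le> n then n else 1)"
    proof (cases "p\<^sup>2 \<le> n")
      case True
      have "p ^ e p \<le> 1 * n" using e_le[OF p] by simp
      also have "\<dots> \<le> p * n" using \<open>p \<ge> 1\<close> by (intro mult_right_mono) auto
      finally show ?thesis using True by simp
    next
      case False
      have "e p < 2"
      proof (rule ccontr)
        assume "\<not> e p < 2"
        then have "p\<^sup>2 \<le> p ^ e p" using \<open>p \<ge> 1\<close> by (intro power_increasing) auto
        with e_le[OF p] False show False by simp
      qed
      then have "p ^ e p \<le> p ^ 1" using \<open>p \<ge> 1\<close> by (intro power_increasing) auto
      with False show ?thesis by simp
    qed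
  qed auto
  also have "\<dots> = \<Prod>(primes_upto n) * (\<Prod>p\<in>primes_upto n. if p\<^sup>2 \<le> n then n else 1)"
    by (simp add: prod.distrib)
  also have "(\<Prod>p\<in>primes_upto n. if p\<^sup>2 \<le> n then n else 1) = n ^ card (primes_upto n \<inter> {p. p\<^sup>2 \<le> n})"
    by (simp add: prod.If_cases)
  also have "primes_upto n \<inter> {p. p\<^sup>2 \<le> n} = {p. prime p \<and> p\<^sup>2 \<le> n}"
  proof -
    have "p \<le> n" if "p\<^sup>2 \<le> n" for p
      using that self_le_power[of p 2] by (cases "p = 0") auto
    then show ?thesis by (auto simp: primes_upto_def)
  qed
  finally show ?thesis .
qed

text \<open>The map \<open>(p - 1) div 2\<close> is injective on primes: it sends 2 to 0 and
  separates the odd ones. Halving the count in this way keeps the later numerical range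
  short.\<close>

lemma card_primes_sqrt_le:
  assumes "n \<ge> 1"
  shows "real (card {p::nat. prime p \<and> p\<^sup>2 \<le> n}) \<le> (sqrt (real n) + 1) / 2"
proof -
  define s where "s = nat \<lfloor>sqrt (real n)\<rfloor>"
  have "sqrt (real n) \<ge> 1" using assms by simp
  then have s: "s \<ge> 1" "real s \<le> sqrt (real n)" by (auto simp: s_def le_nat_floor)
  let ?P = "{p::nat. prime p \<and> p\<^sup>2 \<le> n}"
  have sub: "?P \<subseteq> {2..s}"
  proof safe
    fix p :: nat assume p: "prime p" "p\<^sup>2 \<le> n"
    then have "real (p\<^sup>2) \<le> real n" by (simp only: of_nat_le_iff)
    then have "real p \<le> sqrt (real n)" by (intro real_le_rsqrt) simp
    then show "p \<in> {2..s}"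
      using prime_ge_2_nat[OF p(1)] by (simp add: s_def le_nat_floor)
  qed
  have "inj_on (\<lambda>p. (p - 1) div 2) ?P"
  proof (rule inj_onI)
    fix p q assume pq: "p \<in> ?P" "q \<in> ?P" "(p - 1) div 2 = (q - 1) div 2"
    have odd_or_2: "2 \<le> r \<and> (r = 2 \<or> odd r)" if "r \<in> ?P" for r
      using that prime_odd_nat[of r] prime_ge_2_nat[of r] by auto
    show "p = q"
      using odd_or_2[OF pq(1)] odd_or_2[OF pq(2)] pq(3) by presburger
  qed
  moreover have "(\<lambda>p. (p - 1) div 2) ` ?P \<subseteq> {0..(s - 1) div 2}"
    using sub by (auto intro!: div_le_mono diff_le_mono)
  ultimately have "card ?P \<le> card {0..(s - 1) div 2}"
    by (intro card_inj_on_le) auto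
  then have "2 * card ?P \<le> s + 1" using s(1) by simp
  then have "2 * real (card ?P) \<le> real s + 1" by linarith
  with s(2) show ?thesis by simp
qed

text \<open>Take logarithms in \<open>2 ^ (n - 2) \<le> Lcm {1..n}\<close> and in the bound of the
  latter by the product of the primes times a power of \<open>n\<close>.\<close>

lemma theta_ge:
  assumes "n \<ge> 2"
  shows "(real n - 2) * ln 2 - (sqrt (real n) + 1) / 2 * ln (real n) \<le> theta n"
proof -
  let ?c = "card {p::nat. prime p \<and> p\<^sup>2 \<le> n}"
  have pos: "real (\<Prod>(primes_upto n)) > 0"
    by (auto simp: primes_upto_def prime_gt_0_nat intro!: prod_pos)
  have "(real n - 2) * ln 2 = ln (2 ^ (n - 2))"
    using assms by (simp add: ln_realpow of_nat_diff)
  also have "\<dots> \<le> ln (real (\<Prod>(primes_upto n) * n ^ ?c))"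
  proof (intro iffD2[OF ln_le_cancel_iff])
    have "2 ^ (n - 2) \<le> real (Lcm {1..n})" using Lcm_ge_two_power[OF assms] .
    also have "\<dots> \<le> real (\<Prod>(primes_upto n) * n ^ ?c)"
      using Lcm_le_prod_primes[of n] assms by (simp only: of_nat_le_iff)
    finally show "2 ^ (n - 2) \<le> real (\<Prod>(primes_upto n) * n ^ ?c)" .
    show "0 < real (\<Prod>(primes_upto n) * n ^ ?c)" using pos assms by simp
  qed simp
  also have "\<dots> = theta n + real ?c * ln (real n)"
  proof -
    have "ln (real (\<Prod>(primes_upto n) * n ^ ?c)) = ln (real (\<Prod>(primes_upto n)) * real n ^ ?c)" by simp
    also have "\<dots> = ln (real (\<Prod>(primes_upto n))) + ln (real n ^ ?c)"
      using pos assms by (intro ln_mult_pos) auto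
    also have "ln (real (\<Prod>(primes_upto n))) = theta n"
      unfolding theta_def by (rule sum_ln_eq_ln_prod[symmetric]) (auto simp: primes_upto_def prime_gt_0_nat)
    finally show ?thesis using assms by (simp add: ln_realpow)
  qed
  also have "real ?c * ln (real n) \<le> (sqrt (real n) + 1) / 2 * ln (real n)"
    using card_primes_sqrt_le[of n] assms by (intro mult_right_mono) auto
  finally show ?thesis by simp
qed

section \<open>Explicit values\<close>

text \<open>The Taylor remainder has even order 4, so it is nonnegative for negative
  \<open>w\<close> too; the lower bounds for \<open>ln\<close> use it at \<open>- w\<close>.\<close>

lemma exp_ge_cubic: "1 + w + w\<^sup>2 / 2 + w ^ 3 / 6 \<le> exp (w :: real)"
proof -
  obtain t where "exp w = (\<Sum>m<4. w ^ m / fact m) + exp t / fact 4 * w ^ 4"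
    using Maclaurin_exp_le[of w 4] by blast
  moreover have "exp t / fact 4 * w ^ 4 \<ge> 0" by simp
  ultimately show ?thesis by (simp add: eval_nat_numeral)
qed

text \<open>The two fractions are consecutive convergents of the continued fraction of e. Ten Taylor
  terms with remainder at most \<open>exp 1 / fact 10\<close> separate them.\<close>

lemma exp_1_bounds: "1264 / 465 \<le> exp (1 :: real)" "exp (1 :: real) \<le> 1457 / 536"
proof -
  obtain t :: real where t: "\<bar>t\<bar> \<le> 1" "exp 1 = (\<Sum>m<10. 1 ^ m / fact m) + exp t / fact 10 * 1 ^ (10 :: nat)"
    using Maclaurin_exp_le[of 1 10] by auto
  have S: "(\<Sum>m<10. 1 ^ m / fact m :: real) = 98641 / 36288"
    by (simp add: fact_numeral lessThan_nat_numeral lessThan_Suc eval_nat_numeral)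
  have f: "(fact 10 :: real) = 3628800" by (simp add: fact_numeral)
  have "exp 1 = 98641 / 36288 + exp t / 3628800"
    using t(2) unfolding S f by simp
  moreover have "0 \<le> exp t" "exp t \<le> exp 1" using t(1) by auto
  ultimately show "1264 / 465 \<le> exp (1 :: real)" "exp (1 :: real) \<le> 1457 / 536"
    by linarith+
qed

text \<open>Turns a bound for \<open>ln x\<close> into rational arithmetic: an integer
  \<open>k\<close> close to \<open>ln x\<close> leaves a small \<open>w\<close>, for which the cubic
  is accurate. \<open>ln_ge_via_exp\<close> is the counterpart from below.\<close>

lemma ln_le_via_exp:
  assumes "0 < x" "x \<le> (1264 / 465) ^ k * (1 + w + w\<^sup>2 / 2 + w ^ 3 / 6)"
  shows "ln x \<le> real k + w"
proof -
  note assms(2)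
  also have "(1264 / 465) ^ k * (1 + w + w\<^sup>2 / 2 + w ^ 3 / 6) \<le> (1264 / 465) ^ k * exp w"
    using exp_ge_cubic[of w] by (intro mult_left_mono) auto
  also have "\<dots> \<le> exp 1 ^ k * exp w"
    using exp_1_bounds by (intro mult_right_mono power_mono) auto
  also have "\<dots> = exp (real k + w)" by (simp add: exp_add flip: exp_of_nat_mult)
  finally have "ln x \<le> ln (exp (real k + w))" using assms(1) by (intro ln_mono)
  then show ?thesis by simp
qed

lemma ln_ge_via_exp:
  assumes "0 < x" "(1457 / 536) ^ k \<le> x * (1 - w + w\<^sup>2 / 2 - w ^ 3 / 6)"
  shows "real k + w \<le> ln x"
proof -
  have "exp 1 ^ k \<le> (1457 / 536 :: real) ^ k"
    using exp_1_bounds by (intro power_mono) auto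
  also note assms(2)
  also have "x * (1 - w + w\<^sup>2 / 2 - w ^ 3 / 6) \<le> x * exp (- w)"
    using exp_ge_cubic[of "- w"] assms(1) by (intro mult_left_mono) auto
  finally have "exp 1 ^ k \<le> x / exp w" by (simp add: exp_minus field_simps)
  then have "exp (real k + w) \<le> x" by (simp add: exp_add field_simps flip: exp_of_nat_mult)
  then have "ln (exp (real k + w)) \<le> ln x" by (intro ln_mono) auto
  then show ?thesis by simp
qed

section \<open>Values and bounds of \<open>theta\<close> for small arguments\<close>

lemma theta_eq_ln: "theta n = ln (real (prod_list (filter prime [2..<Suc n])))"
proof -
  have set: "primes_upto n = set (filter prime [2..<Suc n])"
    by (auto simp: primes_upto_def prime_ge_2_nat simp del: upt_Suc)
  have "theta n = ln (real (\<Prod>(primes_upto n)))"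
    unfolding theta_def by (rule sum_ln_eq_ln_prod) (auto simp: primes_upto_def prime_gt_0_nat)
  also have "\<Prod>(primes_upto n) = prod_list (filter prime [2..<Suc n])"
    unfolding set by (subst prod.distinct_set_conv_list) auto
  finally show ?thesis .
qed

lemma theta_small:
  "theta 3 = ln 6" "theta 7 = ln 210" "theta 11 = ln 2310" "theta 13 = ln 30030" "theta 17 = ln 510510"
  "theta 19 = ln 9699690" "theta 23 = ln 223092870" "theta 29 = ln 6469693230"
  "theta 31 = ln 200560490130" "theta 43 = ln 13082761331670030"
  by (simp_all add: theta_eq_ln)

lemma card_primes_upto: "card (primes_upto n) = length (filter prime [2..<Suc n])"
proof -
  have "primes_upto n = set (filter prime [2..<Suc n])"
    by (auto simp: primes_upto_def prime_ge_2_nat simp del: upt_Suc)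
  moreover have "distinct (filter prime [2..<Suc n])" by simp
  ultimately show ?thesis using distinct_card by metis
qed

lemma card_primes_upto_small:
  "card (primes_upto 7) = 4" "card (primes_upto 11) = 5" "card (primes_upto 13) = 6"
  "card (primes_upto 17) = 7" "card (primes_upto 19) = 8" "card (primes_upto 23) = 9"
  "card (primes_upto 29) = 10" "card (primes_upto 31) = 11"
  by (simp_all add: card_primes_upto)

text \<open>Above 17, this predicate agrees with primality for all numbers below \<open>19\<^sup>2 = 361\<close>.\<close>

definition sieve :: "nat \<Rightarrow> bool" where
  "sieve p \<longleftrightarrow> \<not> 2 dvd p \<and> \<not> 3 dvd p \<and> \<not> 5 dvd p \<and> \<not> 7 dvd p \<and> \<not> 11 dvd p \<and> \<not> 13 dvd p \<and> \<not> 17 dvd p"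

text \<open>Every prime above 17 passes \<open>sieve\<close>, so the numbers that pass dominate the
  primes in the interval; a composite among them could only enlarge the right-hand side.\<close>

lemma theta_le_sieve:
  assumes "17 \<le> a" "a \<le> b"
  shows "theta b \<le> theta a + ln (real (prod_list (filter sieve [Suc a..<Suc b])))"
proof -
  let ?S = "set (filter sieve [Suc a..<Suc b])"
  have "\<not> q dvd p" if "prime p" "p > 17" "q \<in> {2, 3, 5, 7, 11, 13, 17}" for p q :: nat
    using that by (auto simp: prime_nat_iff)
  then have sub: "primes_upto b \<subseteq> primes_upto a \<union> ?S"
    using assms by (auto simp: primes_upto_def sieve_def)
  have "theta b \<le> (\<Sum>p\<in>primes_upto a \<union> ?S. ln (real p))"
    unfolding theta_def using sub by (intro sum_mono2) (auto simp: primes_upto_def ln_prime_nonneg)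
  also have "\<dots> = theta a + (\<Sum>p\<in>?S. ln (real p))"
    unfolding theta_def by (intro sum.union_disjoint) (auto simp: primes_upto_def)
  also have "(\<Sum>p\<in>?S. ln (real p)) = ln (real (\<Prod>?S))"
    by (rule sum_ln_eq_ln_prod) auto
  also have "\<Prod>?S = prod_list (filter sieve [Suc a..<Suc b])"
    by (subst prod.distinct_set_conv_list) auto
  finally show ?thesis .
qed

text \<open>Each argument is one less than a prime, so the intervals between consecutive arguments
  start at primes. Each bound is the previous one plus a bound for the logarithm of the product of
  the primes in between; for example \<open>3127 = 53 * 59\<close>.\<close>

lemma theta_table:
  shows "theta 30 \<le> 22.592"
    "theta 36 \<le> 26.028"
    "theta 40 \<le> 29.641"
    "theta 42 \<le> 33.355"
    "theta 46 \<le> 37.117"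
    "theta 52 \<le> 40.968"
    "theta 60 \<le> 49.016"
    "theta 72 \<le> 61.597"
    "theta 96 \<le> 79.167"
    "theta 130 \<le> 111.928"
    "theta 178 \<le> 157.101"
    "theta 250 \<le> 226.612"
    "theta 330 \<le> 300.017"
proof -
  have t23: "theta 23 \<le> 19.224"
    using ln_le_via_exp[of 223092870 19 "0.224"]
    by (simp add: theta_small power_divide power2_eq_square power3_eq_cube)
  have "theta 30 \<le> theta 23 + 3.368"
    using theta_le_sieve[of 23 30] ln_le_via_exp[of 29 3 "0.368"]
    by (simp add: sieve_def power_divide power2_eq_square power3_eq_cube)
  with t23 show t30: "theta 30 \<le> 22.592" by simp
  have "theta 36 \<le> theta 30 + 3.436"
    using theta_le_sieve[of 30 36] ln_le_via_exp[of 31 3 "0.436"]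
    by (simp add: sieve_def power_divide power2_eq_square power3_eq_cube)
  with t30 show t36: "theta 36 \<le> 26.028" by simp
  have "theta 40 \<le> theta 36 + 3.613"
    using theta_le_sieve[of 36 40] ln_le_via_exp[of 37 4 "-0.387"]
    by (simp add: sieve_def power_divide power2_eq_square power3_eq_cube)
  with t36 show t40: "theta 40 \<le> 29.641" by simp
  have "theta 42 \<le> theta 40 + 3.714"
    using theta_le_sieve[of 40 42] ln_le_via_exp[of 41 4 "-0.286"]
    by (simp add: sieve_def power_divide power2_eq_square power3_eq_cube)
  with t40 show t42: "theta 42 \<le> 33.355" by simp
  have "theta 46 \<le> theta 42 + 3.762"
    using theta_le_sieve[of 42 46] ln_le_via_exp[of 43 4 "-0.238"]
    by (simp add: sieve_def power_divide power2_eq_square power3_eq_cube)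
  with t42 show t46: "theta 46 \<le> 37.117" by simp
  have "theta 52 \<le> theta 46 + 3.851"
    using theta_le_sieve[of 46 52] ln_le_via_exp[of 47 4 "-0.149"]
    by (simp add: sieve_def power_divide power2_eq_square power3_eq_cube)
  with t46 show t52: "theta 52 \<le> 40.968" by simp
  have "theta 60 \<le> theta 52 + 8.048"
    using theta_le_sieve[of 52 60] ln_le_via_exp[of 3127 8 "0.048"]
    by (simp add: sieve_def power_divide power2_eq_square power3_eq_cube)
  with t52 show t60: "theta 60 \<le> 49.016" by simp
  have "theta 72 \<le> theta 60 + 12.581"
    using theta_le_sieve[of 60 72] ln_le_via_exp[of 290177 13 "-0.419"]
    by (simp add: sieve_def power_divide power2_eq_square power3_eq_cube)
  with t60 show t72: "theta 72 \<le> 61.597" by simp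
  have "theta 96 \<le> theta 72 + 17.57"
    using theta_le_sieve[of 72 96] ln_le_via_exp[of 42600829 18 "-0.43"]
    by (simp add: sieve_def power_divide power2_eq_square power3_eq_cube)
  with t72 show t96: "theta 96 \<le> 79.167" by simp
  have "theta 130 \<le> theta 96 + 32.761"
    using theta_le_sieve[of 96 130] ln_le_via_exp[of 168897325606883 33 "-0.239"]
    by (simp add: sieve_def power_divide power2_eq_square power3_eq_cube)
  with t96 show t130: "theta 130 \<le> 111.928" by simp
  have "theta 178 \<le> theta 130 + 45.173"
    using theta_le_sieve[of 130 178] ln_le_via_exp[of 41497287518359093727 45 "0.173"]
    by (simp add: sieve_def power_divide power2_eq_square power3_eq_cube)
  with t130 show t178: "theta 178 \<le> 157.101" by simp
  have "theta 250 \<le> theta 178 + 69.511"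
    using theta_le_sieve[of 178 250] ln_le_via_exp[of 1536954840686889060322240561663 70 "-0.489"]
    by (simp add: sieve_def power_divide power2_eq_square power3_eq_cube)
  with t178 show t250: "theta 250 \<le> 226.612" by simp
  have "theta 330 \<le> theta 250 + 73.405"
    using theta_le_sieve[of 250 330] ln_le_via_exp[of 75618258851956430429851527331909 73 "0.405"]
    by (simp add: sieve_def power_divide power2_eq_square power3_eq_cube)
  with t250 show t330: "theta 330 \<le> 300.017" by simp
qed

section \<open>Sets of primes with small product\<close>

definition prime_set_log :: "nat set \<Rightarrow> real" where
  "prime_set_log S = (\<Sum>p\<in>S. ln (real p))"

text \<open>An exchange argument: the primes up to \<open>x\<close> missing from \<open>S\<close>
  are at most \<open>x\<close>, while the members of \<open>S\<close> outside that range exceed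
  \<open>x\<close> and are at least as numerous.\<close>

lemma theta_le_prime_set_log:
  assumes S: "finite S" "\<forall>p\<in>S. prime p" and card: "card (primes_upto x) \<le> card S"
  shows "theta x \<le> prime_set_log S"
proof -
  let ?A = "primes_upto x"
  have "theta x = (\<Sum>p\<in>?A \<inter> S. ln (real p)) + (\<Sum>p\<in>?A - S. ln (real p))"
    unfolding theta_def by (rule sum.Int_Diff) simp
  also have "(\<Sum>p\<in>?A - S. ln (real p)) \<le> (\<Sum>p\<in>S - ?A. ln (real p))"
  proof (cases "?A - S = {}")
    case True
    have "0 \<le> (\<Sum>p\<in>S - ?A. ln (real p))"
      using S by (intro sum_nonneg) (auto simp: ln_prime_nonneg)
    then show ?thesis unfolding True by simp
  next
    case False
    then obtain q where "prime q" "q \<le> x" by (auto simp: primes_upto_def)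
    then have x: "x \<ge> 1" using prime_ge_1_nat[of q] by simp
    have "card (?A - S) \<le> card (S - ?A)"
      using card card_Int_Diff[of ?A S] card_Int_Diff[OF S(1), of ?A] Int_commute[of ?A S] by simp
    then have c: "real (card (?A - S)) \<le> real (card (S - ?A))" by simp
    have "(\<Sum>p\<in>?A - S. ln (real p)) \<le> real (card (?A - S)) * ln (real x)"
      by (rule sum_bounded_above) (auto simp: primes_upto_def prime_gt_0_nat intro!: ln_mono)
    also have "\<dots> \<le> real (card (S - ?A)) * ln (real x)"
      using x c by (intro mult_right_mono) auto
    also have "\<dots> \<le> (\<Sum>p\<in>S - ?A. ln (real p))"
      using S x by (intro sum_bounded_below) (auto simp: primes_upto_def)
    finally show ?thesis .
  qed
  also have "(\<Sum>p\<in>?A \<inter> S. ln (real p)) + (\<Sum>p\<in>S - ?A. ln (real p)) = prime_set_log S"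
    unfolding prime_set_log_def using sum.Int_Diff[OF S(1), of "\<lambda>p. ln (real p)" ?A]
    by (simp add: Int_commute)
  finally show ?thesis by simp
qed

text \<open>A set of primes is built up by adding its elements in increasing order; the property only
  has to survive adding a new maximum \<open>p\<close>, where the logarithmic weight is at most \<open>theta p\<close>.\<close>

lemma prime_set_induct [consumes 3, case_names base step]:
  assumes "finite S" "\<forall>p\<in>S. prime p" "card (primes_upto q) \<le> card S"
    and base: "\<And>S. finite S \<Longrightarrow> \<forall>p\<in>S. prime p \<Longrightarrow> card S = card (primes_upto q) \<Longrightarrow> P (card S) (prime_set_log S)"
    and step: "\<And>r L p. prime p \<Longrightarrow> q < p \<Longrightarrow> theta q \<le> L \<Longrightarrow> L + ln (real p) \<le> theta p \<Longrightarrow>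
                 P r L \<Longrightarrow> P (Suc r) (L + ln (real p))"
  shows "P (card S) (prime_set_log S)"
  using assms(1-3)
proof (induction "card S - card (primes_upto q)" arbitrary: S)
  case 0
  then show ?case by (intro base) auto
next
  case (Suc k)
  then have ne: "S \<noteq> {}" by auto
  define p where "p = Max S"
  have "p \<in> S" unfolding p_def using Suc.prems(1) ne by (rule Max_in)
  moreover from this have "prime p" using Suc.prems(2) by blast
  ultimately have p: "p \<in> S" "prime p" by auto
  let ?T = "S - {p}"
  have sub: "S \<subseteq> primes_upto p"
    using Suc.prems(1,2) by (auto simp: primes_upto_def p_def)
  have log: "prime_set_log S = prime_set_log ?T + ln (real p)"
    unfolding prime_set_log_def using sum.remove[OF Suc.prems(1) p(1), of "\<lambda>p. ln (real p)"] by simp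
  have card: "card S = Suc (card ?T)"
    using card.remove[OF Suc.prems(1) p(1)] .
  have "q < p"
  proof (rule ccontr)
    assume "\<not> q < p"
    then have "S \<subseteq> primes_upto q" using sub by (auto simp: primes_upto_def)
    then have "card S \<le> card (primes_upto q)" by (intro card_mono) auto
    with Suc.hyps show False by simp
  qed
  \<comment> \<open>Without its maximum, the set still has at least as many elements as there are
    primes up to \<open>q\<close>.\<close>
  moreover have "theta q \<le> prime_set_log ?T"
    using Suc card by (intro theta_le_prime_set_log) auto
  moreover have "prime_set_log ?T + ln (real p) \<le> theta p"
  proof -
    have "prime_set_log S \<le> theta p"
      unfolding prime_set_log_def theta_def using sub
      by (intro sum_mono2) (auto simp: primes_upto_def ln_prime_nonneg)
    then show ?thesis by (simp add: log)
  qed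
  moreover have "P (card ?T) (prime_set_log ?T)"
    using Suc.prems Suc.hyps(2) card by (intro Suc.hyps(1)) auto
  ultimately show ?case
    unfolding card log using p by (blast intro: step)
qed

section \<open>Growth of \<open>L / ln L\<close> and of \<open>ratio_bound\<close>\<close>

text \<open>With \<open>L = ln n\<close> this is the upper end of the interval of radius
  \<open>2 * L / (ln L)\<^sup>2\<close> about \<open>L / ln L\<close>.\<close>

definition ratio_bound :: "real \<Rightarrow> real" where
  "ratio_bound L = L / ln L + 2 * L / (ln L)\<^sup>2"

lemma ratio_ln_mono:
  assumes "exp 1 \<le> y" "y \<le> L"
  shows "y / ln y \<le> L / (ln L :: real)"
proof -
  have pos: "0 < y" "0 < L" using less_le_trans[OF exp_gt_zero assms(1)] assms(2) by auto
  have "1 \<le> ln y" using assms(1) pos by (simp add: ln_ge_iff)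
  moreover have "1 \<le> ln L" using assms pos by (simp add: ln_ge_iff)
  ultimately have "0 < ln y" "0 < ln L" by auto
  then show ?thesis
    using ln_x_over_x_mono[OF assms] pos by (simp add: field_simps)
qed

text \<open>The second term is half the square of \<open>sqrt L / ln (sqrt L)\<close>, so both terms
  increase by \<open>ratio_ln_mono\<close>; the square root turns the threshold \<open>exp 1\<close>
  into \<open>exp 2\<close>.\<close>

lemma ratio_bound_mono:
  assumes "exp 2 \<le> y" "y \<le> L"
  shows "ratio_bound y \<le> ratio_bound L"
proof -
  have pos: "0 < y" "0 < L" using less_le_trans[OF exp_gt_zero assms(1)] assms(2) by auto
  have "exp 1 \<le> (exp 2 :: real)" by simp
  then have e: "exp 1 \<le> y" using assms by linarith
  have "exp 2 = (exp 1 :: real)\<^sup>2" by (simp flip: exp_of_nat_mult)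
  then have "exp 1 \<le> sqrt y" using assms(1) by (intro real_le_rsqrt) simp
  moreover have "sqrt y \<le> sqrt L" using assms by simp
  ultimately have "sqrt y / ln (sqrt y) \<le> sqrt L / ln (sqrt L)" by (rule ratio_ln_mono)
  moreover have "0 \<le> sqrt y / ln (sqrt y)"
    using e exp_ge_add_one_self[of 1] pos by (simp add: ln_sqrt)
  ultimately have "(sqrt y / ln (sqrt y))\<^sup>2 \<le> (sqrt L / ln (sqrt L))\<^sup>2"
    by (intro power_mono)
  then have "4 * (y / (ln y)\<^sup>2) \<le> 4 * (L / (ln L)\<^sup>2)"
    using pos by (simp add: ln_sqrt power_divide mult.commute)
  then have "2 * y / (ln y)\<^sup>2 \<le> 2 * L / (ln L)\<^sup>2" by simp
  with ratio_ln_mono[OF e assms(2)] show ?thesis by (simp add: ratio_bound_def)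
qed

lemma exp_le_via: "(1457 / 536) ^ k \<le> y \<Longrightarrow> exp (real k) \<le> y"
proof -
  assume "(1457 / 536) ^ k \<le> y"
  moreover have "exp (real k) = exp 1 ^ k" by (simp flip: exp_of_nat_mult)
  moreover have "exp 1 ^ k \<le> (1457 / 536 :: real) ^ k"
    using exp_1_bounds by (intro power_mono) auto
  ultimately show ?thesis by linarith
qed

text \<open>Mean value theorem: with \<open>u = ln x\<close>, the derivative of
  \<open>ratio_bound\<close> at \<open>x\<close> is
  \<open>1 / u + 1 / u\<^sup>2 - 4 / u ^ 3\<close>. The threshold 20.1 lies just above
  \<open>exp 3\<close> and gives \<open>u \<ge> 3\<close>, where this derivative decreases in
  \<open>u\<close>.\<close>

lemma ratio_bound_step:
  assumes L: "20.1 \<le> L" and d: "0 \<le> d"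
    and slope: "\<And>u. 3 \<le> u \<Longrightarrow> u \<le> ln (L + d) \<Longrightarrow> 1 \<le> d * (1 / u + 1 / u\<^sup>2 - 4 / u ^ 3)"
  shows "ratio_bound L + 1 \<le> ratio_bound (L + d)"
proof -
  have "exp (real 3) \<le> 20.1" by (rule exp_le_via) (simp add: power_divide)
  then have ln3: "3 \<le> ln x" if "L \<le> x" for x
    using that L by (subst ln_ge_iff) auto
  have "d \<noteq> 0" using slope[of 3] ln3[of "L + d"] d by auto
  with d have "L < L + d" by simp
  have deriv: "(ratio_bound has_real_derivative (1 / ln x + 1 / (ln x)\<^sup>2 - 4 / ln x ^ 3)) (at x)"
    if "L \<le> x" "x \<le> L + d" for x
  proof -
    have x: "x > 0" "ln x \<noteq> 0" using that L ln3[of x] by auto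
    have "(ratio_bound has_real_derivative ((1 * ln x - x * (1 / x)) / (ln x * ln x)
        + (2 * (ln x)\<^sup>2 - 2 * x * (2 * ln x * (1 / x))) / ((ln x)\<^sup>2 * (ln x)\<^sup>2))) (at x)"
      unfolding ratio_bound_def using x by (auto intro!: derivative_eq_intros)
    also have "(1 * ln x - x * (1 / x)) / (ln x * ln x)
        + (2 * (ln x)\<^sup>2 - 2 * x * (2 * ln x * (1 / x))) / ((ln x)\<^sup>2 * (ln x)\<^sup>2)
      = 1 / ln x + 1 / (ln x)\<^sup>2 - 4 / ln x ^ 3"
      using x by (simp add: divide_simps power2_eq_square power3_eq_cube) (simp add: algebra_simps)
    finally show ?thesis .
  qed
  have "\<exists>z>L. z < L + d \<and>
      ratio_bound (L + d) - ratio_bound L = (L + d - L) * (1 / ln z + 1 / (ln z)\<^sup>2 - 4 / ln z ^ 3)"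
    by (rule MVT2[OF \<open>L < L + d\<close> deriv])
  then obtain z where z: "L < z" "z < L + d"
    "ratio_bound (L + d) - ratio_bound L = (L + d - L) * (1 / ln z + 1 / (ln z)\<^sup>2 - 4 / ln z ^ 3)"
    by blast
  have "1 \<le> d * (1 / ln z + 1 / (ln z)\<^sup>2 - 4 / ln z ^ 3)"
    using z ln3[of z] L by (intro slope) auto
  with z(3) show ?thesis by simp
qed

lemma ratio_ln_derivative:
  assumes "exp 2 \<le> x"
  shows "((\<lambda>x. x / ln x) has_real_derivative (1 / ln x - 1 / (ln x)\<^sup>2)) (at x)"
proof -
  have x: "x > 0" using assms exp_gt_zero[of 2] by linarith
  then have "ln x \<ge> 2" using assms by (simp add: ln_ge_iff)
  then have "ln x \<noteq> 0" by auto
  with x have "((\<lambda>x. x / ln x) has_real_derivative ((1 * ln x - x * (1 / x)) / (ln x * ln x))) (at x)"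
    by (auto intro!: derivative_eq_intros)
  also have "(1 * ln x - x * (1 / x)) / (ln x * ln x) = 1 / ln x - 1 / (ln x)\<^sup>2"
    using x \<open>ln x \<noteq> 0\<close> by (simp add: diff_divide_distrib power2_eq_square)
  finally show ?thesis .
qed

lemma ratio_ln_MVT:
  fixes L d :: real
  assumes "exp 2 \<le> L" "0 < d"
  obtains u where "ln L \<le> u" "u \<le> ln (L + d)" "2 \<le> u"
    "(L + d) / ln (L + d) - L / ln L = d * (1 / u - 1 / u\<^sup>2)"
proof -
  have "\<exists>z>L. z < L + d \<and>
      (L + d) / ln (L + d) - L / ln L = (L + d - L) * (1 / ln z - 1 / (ln z)\<^sup>2)"
    by (rule MVT2) (use assms in \<open>auto intro!: ratio_ln_derivative\<close>)
  then obtain z where z: "L < z" "z < L + d"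
    "(L + d) / ln (L + d) - L / ln L = (L + d - L) * (1 / ln z - 1 / (ln z)\<^sup>2)"
    by blast
  have "L > 0" using assms exp_gt_zero[of 2] by linarith
  moreover have "2 \<le> ln L" using assms \<open>L > 0\<close> by (simp add: ln_ge_iff)
  moreover have "ln L \<le> ln z" "ln z \<le> ln (L + d)" using z \<open>L > 0\<close> by auto
  ultimately show ?thesis using z(3) by (intro that[of "ln z"]) auto
qed

text \<open>In terms of \<open>t = 1 / u\<close> the expression is
  \<open>t + t\<^sup>2 - 4 * t ^ 3\<close>, whose difference quotient is nonnegative for arguments
  in \<open>[0, 1/3]\<close>.\<close>

lemma gslope_antimono:
  assumes "3 \<le> u" "u \<le> (v :: real)"
  shows "1 / v + 1 / v\<^sup>2 - 4 / v ^ 3 \<le> 1 / u + 1 / u\<^sup>2 - 4 / u ^ 3"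
proof -
  define s t where "s = 1 / v" and "t = 1 / u"
  have st: "0 \<le> s" "s \<le> t" "t \<le> 1 / 3"
    using assms by (auto simp: s_def t_def field_simps)
  have "t * t \<le> 1 / 9" "t * s \<le> 1 / 9" "s * s \<le> 1 / 9"
    using mult_mono[of t "1/3" t "1/3"] mult_mono[of t "1/3" s "1/3"] mult_mono[of s "1/3" s "1/3"] st by auto
  moreover have "(t + t\<^sup>2 - 4 * t ^ 3) - (s + s\<^sup>2 - 4 * s ^ 3)
      = (t - s) * (1 + (t + s) - 4 * (t * t + t * s + s * s))"
    by (simp add: power2_eq_square power3_eq_cube algebra_simps)
  moreover have "4 * (t * t + t * s + s * s) \<le> 1 + (t + s)"
  proof -
    have "t * t \<le> t / 3" "t * s \<le> s / 3" "s * s \<le> s / 3"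
      using mult_left_mono[of t "1/3" t] mult_right_mono[of t "1/3" s] mult_right_mono[of s "1/3" s] st by auto
    then have "t * t + t * s + s * s \<le> t / 3 + 2 * s / 3" by linarith
    then have "4 * (t * t + t * s + s * s) \<le> 4 * (t / 3 + 2 * s / 3)" by simp
    also have "\<dots> \<le> 1 + (t + s)" using st by simp
    finally show ?thesis .
  qed
  ultimately have "s + s\<^sup>2 - 4 * s ^ 3 \<le> t + t\<^sup>2 - 4 * t ^ 3"
    using mult_nonneg_nonneg[of "t - s" "1 + (t + s) - 4 * (t * t + t * s + s * s)"] st by linarith
  then show ?thesis by (simp add: s_def t_def power_one_over)
qed

lemma fslope_antimono:
  assumes "2 \<le> u" "u \<le> (v :: real)"
  shows "1 / v - 1 / v\<^sup>2 \<le> 1 / u - 1 / u\<^sup>2"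
proof -
  define s t where "s = 1 / v" and "t = 1 / u"
  have st: "0 \<le> s" "s \<le> t" "t \<le> 1 / 2"
    using assms by (auto simp: s_def t_def field_simps)
  have "(t - t\<^sup>2) - (s - s\<^sup>2) = (t - s) * (1 - (t + s))"
    by (simp add: power2_eq_square algebra_simps)
  moreover have "0 \<le> (t - s) * (1 - (t + s))" using st by (intro mult_nonneg_nonneg) auto
  ultimately have "s - s\<^sup>2 \<le> t - t\<^sup>2" by linarith
  then show ?thesis by (simp add: s_def t_def power_one_over)
qed

text \<open>By monotonicity it suffices to treat the largest \<open>u\<close> and the smallest
  \<open>l\<close>; clearing denominators then leaves one polynomial inequality in the constants
  \<open>v\<close> and \<open>w\<close>. \<open>fslope_ge\<close> does the same for
  \<open>L / ln L\<close>.\<close>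

lemma gslope_ge:
  fixes u v w l :: real
  assumes "3 \<le> u" "u \<le> v" "w \<le> l" "0 \<le> w" "v ^ 3 \<le> w * (v\<^sup>2 + v - 4)"
  shows "1 \<le> l * (1 / u + 1 / u\<^sup>2 - 4 / u ^ 3)"
proof -
  have v: "v \<ge> 3" "v > 0" using assms by auto
  have F: "1 / v + 1 / v\<^sup>2 - 4 / v ^ 3 = (v\<^sup>2 + v - 4) / v ^ 3"
    using v by (simp add: field_simps power2_eq_square power3_eq_cube)
  have "0 \<le> v\<^sup>2 + v - 4" using v power_mono[of 3 v 2] by simp
  have "1 \<le> w * ((v\<^sup>2 + v - 4) / v ^ 3)"
    using assms(5) v by (simp add: field_simps)
  also have "\<dots> \<le> l * ((v\<^sup>2 + v - 4) / v ^ 3)"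
    using assms(3) v \<open>0 \<le> v\<^sup>2 + v - 4\<close> by (intro mult_right_mono) auto
  also have "\<dots> \<le> l * (1 / u + 1 / u\<^sup>2 - 4 / u ^ 3)"
    unfolding F[symmetric] using gslope_antimono[OF assms(1,2)] assms(3,4) by (intro mult_left_mono) auto
  finally show ?thesis .
qed

lemma fslope_ge:
  fixes u v w l c :: real
  assumes "2 \<le> u" "u \<le> v" "w \<le> l" "0 \<le> w" "v\<^sup>2 \<le> c * w * (v - 1)" "0 \<le> c"
  shows "1 \<le> c * l * (1 / u - 1 / u\<^sup>2)"
proof -
  have v: "v \<ge> 2" "v > 0" using assms by auto
  have F: "1 / v - 1 / v\<^sup>2 = (v - 1) / v\<^sup>2"
    using v by (simp add: field_simps power2_eq_square)
  have "1 \<le> c * w * ((v - 1) / v\<^sup>2)"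
    using assms(5) v by (simp add: field_simps)
  also have "\<dots> \<le> c * l * ((v - 1) / v\<^sup>2)"
    using assms v by (intro mult_right_mono mult_left_mono) auto
  also have "\<dots> \<le> c * l * (1 / u - 1 / u\<^sup>2)"
    unfolding F[symmetric] using fslope_antimono[OF assms(1,2)] assms by (intro mult_left_mono) auto
  finally show ?thesis .
qed

section \<open>Comparison of \<open>ln p\<close> with \<open>ln (theta p)\<close>\<close>

lemma theta_pos: "3 \<le> p \<Longrightarrow> 0 < theta p"
  using theta_mono[of 3 p] theta_small(1) by (simp add: less_le_trans[OF ln_gt_zero[of 6]])

lemma ln_theta_interval:
  assumes "a \<le> p" "p \<le> b" "3 \<le> a" "theta b \<le> B" "ln B \<le> v" "w \<le> ln (real a)"
  shows "w \<le> ln (real p) \<and> ln (theta p) \<le> v"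
proof -
  have "0 < theta p" using assms by (intro theta_pos) simp
  moreover have "theta p \<le> B" using theta_mono[OF assms(2)] assms(4) by linarith
  ultimately have "ln (theta p) \<le> ln B" by (intro ln_mono)
  moreover have "ln (real a) \<le> ln (real p)" using assms by (intro ln_mono) auto
  ultimately show ?thesis using assms by linarith
qed

text \<open>On each interval, \<open>ln p\<close> is bounded below at the left end and
  \<open>theta p\<close> is bounded above at the right end by \<open>theta_table\<close>.\<close>

lemma ln_theta_table:
  shows "29 \<le> p \<Longrightarrow> p \<le> 30 \<Longrightarrow> 3.366 \<le> ln (real p) \<and> ln (theta p) \<le> 3.118"
    "31 \<le> p \<Longrightarrow> p \<le> 36 \<Longrightarrow> 3.431 \<le> ln (real p) \<and> ln (theta p) \<le> 3.26"
    "37 \<le> p \<Longrightarrow> p \<le> 40 \<Longrightarrow> 3.61 \<le> ln (real p) \<and> ln (theta p) \<le> 3.39"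
    "41 \<le> p \<Longrightarrow> p \<le> 42 \<Longrightarrow> 3.713 \<le> ln (real p) \<and> ln (theta p) \<le> 3.511"
    "43 \<le> p \<Longrightarrow> p \<le> 46 \<Longrightarrow> 3.761 \<le> ln (real p) \<and> ln (theta p) \<le> 3.616"
    "47 \<le> p \<Longrightarrow> p \<le> 52 \<Longrightarrow> 3.85 \<le> ln (real p) \<and> ln (theta p) \<le> 3.714"
    "53 \<le> p \<Longrightarrow> p \<le> 60 \<Longrightarrow> 3.97 \<le> ln (real p) \<and> ln (theta p) \<le> 3.893"
    "61 \<le> p \<Longrightarrow> p \<le> 72 \<Longrightarrow> 4.11 \<le> ln (real p) \<and> ln (theta p) \<le> 4.121"
    "73 \<le> p \<Longrightarrow> p \<le> 96 \<Longrightarrow> 4.29 \<le> ln (real p) \<and> ln (theta p) \<le> 4.373"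
    "97 \<le> p \<Longrightarrow> p \<le> 130 \<Longrightarrow> 4.573 \<le> ln (real p) \<and> ln (theta p) \<le> 4.719"
    "131 \<le> p \<Longrightarrow> p \<le> 178 \<Longrightarrow> 4.875 \<le> ln (real p) \<and> ln (theta p) \<le> 5.057"
    "179 \<le> p \<Longrightarrow> p \<le> 250 \<Longrightarrow> 5.187 \<le> ln (real p) \<and> ln (theta p) \<le> 5.425"
    "251 \<le> p \<Longrightarrow> p \<le> 330 \<Longrightarrow> 5.523 \<le> ln (real p) \<and> ln (theta p) \<le> 5.705"
proof -
  show "3.366 \<le> ln (real p) \<and> ln (theta p) \<le> 3.118" if "29 \<le> p" "p \<le> 30"
    by (rule ln_theta_interval[OF that _ theta_table(1)])
      (use ln_le_via_exp[of "22.592" 3 "0.118"]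
        ln_ge_via_exp[of "29" 3 "0.366"] in
        \<open>simp_all add: power_divide power2_eq_square power3_eq_cube\<close>)
  show "3.431 \<le> ln (real p) \<and> ln (theta p) \<le> 3.26" if "31 \<le> p" "p \<le> 36"
    by (rule ln_theta_interval[OF that _ theta_table(2)])
      (use ln_le_via_exp[of "26.028" 3 "0.26"]
        ln_ge_via_exp[of "31" 3 "0.431"] in
        \<open>simp_all add: power_divide power2_eq_square power3_eq_cube\<close>)
  show "3.61 \<le> ln (real p) \<and> ln (theta p) \<le> 3.39" if "37 \<le> p" "p \<le> 40"
    by (rule ln_theta_interval[OF that _ theta_table(3)])
      (use ln_le_via_exp[of "29.641" 3 "0.39"]
        ln_ge_via_exp[of "37" 4 "-0.39"] in
        \<open>simp_all add: power_divide power2_eq_square power3_eq_cube\<close>)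
  show "3.713 \<le> ln (real p) \<and> ln (theta p) \<le> 3.511" if "41 \<le> p" "p \<le> 42"
    by (rule ln_theta_interval[OF that _ theta_table(4)])
      (use ln_le_via_exp[of "33.355" 4 "-0.489"]
        ln_ge_via_exp[of "41" 4 "-0.287"] in
        \<open>simp_all add: power_divide power2_eq_square power3_eq_cube\<close>)
  show "3.761 \<le> ln (real p) \<and> ln (theta p) \<le> 3.616" if "43 \<le> p" "p \<le> 46"
    by (rule ln_theta_interval[OF that _ theta_table(5)])
      (use ln_le_via_exp[of "37.117" 4 "-0.384"]
        ln_ge_via_exp[of "43" 4 "-0.239"] in
        \<open>simp_all add: power_divide power2_eq_square power3_eq_cube\<close>)
  show "3.85 \<le> ln (real p) \<and> ln (theta p) \<le> 3.714" if "47 \<le> p" "p \<le> 52"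
    by (rule ln_theta_interval[OF that _ theta_table(6)])
      (use ln_le_via_exp[of "40.968" 4 "-0.286"]
        ln_ge_via_exp[of "47" 4 "-0.15"] in
        \<open>simp_all add: power_divide power2_eq_square power3_eq_cube\<close>)
  show "3.97 \<le> ln (real p) \<and> ln (theta p) \<le> 3.893" if "53 \<le> p" "p \<le> 60"
    by (rule ln_theta_interval[OF that _ theta_table(7)])
      (use ln_le_via_exp[of "49.016" 4 "-0.107"]
        ln_ge_via_exp[of "53" 4 "-0.03"] in
        \<open>simp_all add: power_divide power2_eq_square power3_eq_cube\<close>)
  show "4.11 \<le> ln (real p) \<and> ln (theta p) \<le> 4.121" if "61 \<le> p" "p \<le> 72"
    by (rule ln_theta_interval[OF that _ theta_table(8)])
      (use ln_le_via_exp[of "61.597" 4 "0.121"]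
        ln_ge_via_exp[of "61" 4 "0.11"] in
        \<open>simp_all add: power_divide power2_eq_square power3_eq_cube\<close>)
  show "4.29 \<le> ln (real p) \<and> ln (theta p) \<le> 4.373" if "73 \<le> p" "p \<le> 96"
    by (rule ln_theta_interval[OF that _ theta_table(9)])
      (use ln_le_via_exp[of "79.167" 4 "0.373"]
        ln_ge_via_exp[of "73" 4 "0.29"] in
        \<open>simp_all add: power_divide power2_eq_square power3_eq_cube\<close>)
  show "4.573 \<le> ln (real p) \<and> ln (theta p) \<le> 4.719" if "97 \<le> p" "p \<le> 130"
    by (rule ln_theta_interval[OF that _ theta_table(10)])
      (use ln_le_via_exp[of "111.928" 5 "-0.281"]
        ln_ge_via_exp[of "97" 5 "-0.427"] in
        \<open>simp_all add: power_divide power2_eq_square power3_eq_cube\<close>)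
  show "4.875 \<le> ln (real p) \<and> ln (theta p) \<le> 5.057" if "131 \<le> p" "p \<le> 178"
    by (rule ln_theta_interval[OF that _ theta_table(11)])
      (use ln_le_via_exp[of "157.101" 5 "0.057"]
        ln_ge_via_exp[of "131" 5 "-0.125"] in
        \<open>simp_all add: power_divide power2_eq_square power3_eq_cube\<close>)
  show "5.187 \<le> ln (real p) \<and> ln (theta p) \<le> 5.425" if "179 \<le> p" "p \<le> 250"
    by (rule ln_theta_interval[OF that _ theta_table(12)])
      (use ln_le_via_exp[of "226.612" 5 "0.425"]
        ln_ge_via_exp[of "179" 5 "0.187"] in
        \<open>simp_all add: power_divide power2_eq_square power3_eq_cube\<close>)
  show "5.523 \<le> ln (real p) \<and> ln (theta p) \<le> 5.705" if "251 \<le> p" "p \<le> 330"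
    by (rule ln_theta_interval[OF that _ theta_table(13)])
      (use ln_le_via_exp[of "300.017" 6 "-0.295"]
        ln_ge_via_exp[of "251" 6 "-0.477"] in
        \<open>simp_all add: power_divide power2_eq_square power3_eq_cube\<close>)
qed

text \<open>Chebyshev's upper bound in logarithmic form; 41/125 bounds \<open>ln (ln 4)\<close> from
  above.\<close>

lemma ln_theta_le: "1 \<le> theta p \<Longrightarrow> ln (theta p) \<le> ln (real p) + 41 / 125"
proof -
  assume "1 \<le> theta p"
  then have p: "p > 0" using theta_le[of p] by (cases p) auto
  have l4: "ln 4 \<le> (1.387 :: real)"
    using ln_le_via_exp[of 4 1 "0.387"] by (simp add: power_divide power2_eq_square power3_eq_cube)
  have "theta p \<le> real p * ln 4" by (rule theta_le)
  also have "\<dots> \<le> real p * 1.387" using l4 by (intro mult_left_mono) auto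
  finally have "ln (theta p) \<le> ln (real p * 1.387)" using \<open>1 \<le> theta p\<close> by (intro ln_mono) auto
  also have "\<dots> = ln (real p) + ln 1.387" using p by (intro ln_mult_pos) auto
  also have "ln 1.387 \<le> (41 / 125 :: real)"
    using ln_le_via_exp[of "1.387" 0 "41/125"] by (simp add: power_divide power2_eq_square power3_eq_cube)
  finally show ?thesis by simp
qed

text \<open>Supplies the slope condition of \<open>ratio_bound_step\<close> for
  \<open>d = ln p\<close>: from the table up to 330, and from Chebyshev's bound beyond.\<close>

lemma gslope_prime:
  assumes "37 \<le> p" "3 \<le> u" "u \<le> ln (theta p)"
  shows "1 \<le> ln (real p) * (1 / u + 1 / u\<^sup>2 - 4 / u ^ 3)"
proof -
  consider "37 \<le> p" "p \<le> 40" | "41 \<le> p" "p \<le> 42" | "43 \<le> p" "p \<le> 46"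
    | "47 \<le> p" "p \<le> 52" | "53 \<le> p" "p \<le> 60" | "61 \<le> p" "p \<le> 72"
    | "73 \<le> p" "p \<le> 96" | "97 \<le> p" "p \<le> 130" | "131 \<le> p" "p \<le> 178"
    | "179 \<le> p" "p \<le> 250" | "251 \<le> p" "p \<le> 330" | "331 \<le> p"
    using assms by linarith
  then show ?thesis
  proof cases
    case 1
    with ln_theta_table(3)[of p] assms show ?thesis
      by (intro gslope_ge[of u "3.39" "3.61"]) (auto simp: power2_eq_square power3_eq_cube)
  next
    case 2
    with ln_theta_table(4)[of p] assms show ?thesis
      by (intro gslope_ge[of u "3.511" "3.713"]) (auto simp: power2_eq_square power3_eq_cube)
  next
    case 3
    with ln_theta_table(5)[of p] assms show ?thesis
      by (intro gslope_ge[of u "3.616" "3.761"]) (auto simp: power2_eq_square power3_eq_cube)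
  next
    case 4
    with ln_theta_table(6)[of p] assms show ?thesis
      by (intro gslope_ge[of u "3.714" "3.85"]) (auto simp: power2_eq_square power3_eq_cube)
  next
    case 5
    with ln_theta_table(7)[of p] assms show ?thesis
      by (intro gslope_ge[of u "3.893" "3.97"]) (auto simp: power2_eq_square power3_eq_cube)
  next
    case 6
    with ln_theta_table(8)[of p] assms show ?thesis
      by (intro gslope_ge[of u "4.121" "4.11"]) (auto simp: power2_eq_square power3_eq_cube)
  next
    case 7
    with ln_theta_table(9)[of p] assms show ?thesis
      by (intro gslope_ge[of u "4.373" "4.29"]) (auto simp: power2_eq_square power3_eq_cube)
  next
    case 8
    with ln_theta_table(10)[of p] assms show ?thesis
      by (intro gslope_ge[of u "4.719" "4.573"]) (auto simp: power2_eq_square power3_eq_cube)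
  next
    case 9
    with ln_theta_table(11)[of p] assms show ?thesis
      by (intro gslope_ge[of u "5.057" "4.875"]) (auto simp: power2_eq_square power3_eq_cube)
  next
    case 10
    with ln_theta_table(12)[of p] assms show ?thesis
      by (intro gslope_ge[of u "5.425" "5.187"]) (auto simp: power2_eq_square power3_eq_cube)
  next
    case 11
    with ln_theta_table(13)[of p] assms show ?thesis
      by (intro gslope_ge[of u "5.705" "5.523"]) (auto simp: power2_eq_square power3_eq_cube)
  next
    case 12
    define w where "w = ln (real p)"
    have "5.802 \<le> ln (331 :: real)"
      using ln_ge_via_exp[of "331" 6 "-0.198"] by (simp add: power_divide power2_eq_square power3_eq_cube)
    also have "\<dots> \<le> w" unfolding w_def using 12 by (intro ln_mono) auto
    finally have w: "2901 / 500 \<le> w" by simp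
    have "1 \<le> theta p"
      using theta_mono[OF assms(1)] theta_mono[of 31 37] theta_small(9) ln_ge_via_exp[of 200560490130 1 0] by simp
    then have "u \<le> w + 41 / 125" using ln_theta_le[of p] assms unfolding w_def by linarith
    moreover have "(w + 41 / 125) ^ 3 \<le> w * ((w + 41 / 125)\<^sup>2 + (w + 41 / 125) - 4)"
    proof -
      \<comment> \<open>With \<open>v = w + 41/125\<close> the cubic terms cancel. The remaining
        quadratic has its positive root near 5.79, just below \<open>ln 331\<close>, which is why
        the table extends to 330.\<close>
      have "w * ((w + 41 / 125)\<^sup>2 + (w + 41 / 125) - 4) - (w + 41 / 125) ^ 3
        = 84 / 125 * (w * w) - 60737 / 15625 * w - 68921 / 1953125"
        by (simp add: power2_eq_square power3_eq_cube field_simps)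
      moreover have "2901 / 500 * w \<le> w * w" using w by (intro mult_right_mono) auto
      then have "0 \<le> 84 / 125 * (w * w) - 60737 / 15625 * w - 68921 / 1953125" using w by linarith
      ultimately show ?thesis by linarith
    qed
    ultimately show ?thesis
      unfolding w_def[symmetric] using w assms by (intro gslope_ge[of u "w + 41 / 125" w]) auto
  qed
qed

text \<open>The cap 5.207 slightly exceeds \<open>2 / 0.3841\<close>; for larger \<open>ln L\<close>
  the factor \<open>1 + 2 / ln L\<close> in \<open>ratio_bound\<close> is already below 1.3841. The
  cap also settles all \<open>p \<ge> 131\<close> at once.\<close>

lemma fslope_prime:
  assumes "29 \<le> p" "2 \<le> u" "u \<le> ln (theta p)" "u \<le> 5.207"
  shows "1 \<le> 1.3841 * ln (real p) * (1 / u - 1 / u\<^sup>2)"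
proof -
  consider "29 \<le> p" "p \<le> 30" | "31 \<le> p" "p \<le> 36" | "37 \<le> p" "p \<le> 40"
    | "41 \<le> p" "p \<le> 42" | "43 \<le> p" "p \<le> 46" | "47 \<le> p" "p \<le> 52"
    | "53 \<le> p" "p \<le> 60" | "61 \<le> p" "p \<le> 72" | "73 \<le> p" "p \<le> 96"
    | "97 \<le> p" "p \<le> 130" | "131 \<le> p"
    using assms by linarith
  then show ?thesis
  proof cases
    case 1
    with ln_theta_table(1)[of p] assms show ?thesis
      by (intro fslope_ge[of u "3.118" "3.366"]) (auto simp: power2_eq_square)
  next
    case 2
    with ln_theta_table(2)[of p] assms show ?thesis
      by (intro fslope_ge[of u "3.26" "3.431"]) (auto simp: power2_eq_square)
  next
    case 3
    with ln_theta_table(3)[of p] assms show ?thesis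
      by (intro fslope_ge[of u "3.39" "3.61"]) (auto simp: power2_eq_square)
  next
    case 4
    with ln_theta_table(4)[of p] assms show ?thesis
      by (intro fslope_ge[of u "3.511" "3.713"]) (auto simp: power2_eq_square)
  next
    case 5
    with ln_theta_table(5)[of p] assms show ?thesis
      by (intro fslope_ge[of u "3.616" "3.761"]) (auto simp: power2_eq_square)
  next
    case 6
    with ln_theta_table(6)[of p] assms show ?thesis
      by (intro fslope_ge[of u "3.714" "3.85"]) (auto simp: power2_eq_square)
  next
    case 7
    with ln_theta_table(7)[of p] assms show ?thesis
      by (intro fslope_ge[of u "3.893" "3.97"]) (auto simp: power2_eq_square)
  next
    case 8
    with ln_theta_table(8)[of p] assms show ?thesis
      by (intro fslope_ge[of u "4.121" "4.11"]) (auto simp: power2_eq_square)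
  next
    case 9
    with ln_theta_table(9)[of p] assms show ?thesis
      by (intro fslope_ge[of u "4.373" "4.29"]) (auto simp: power2_eq_square)
  next
    case 10
    with ln_theta_table(10)[of p] assms show ?thesis
      by (intro fslope_ge[of u "4.719" "4.573"]) (auto simp: power2_eq_square)
  next
    case 11
    have "4.875 \<le> ln (131 :: real)"
      using ln_ge_via_exp[of "131" 5 "-0.125"] by (simp add: power_divide power2_eq_square power3_eq_cube)
    also have "\<dots> \<le> ln (real p)" using 11 by (intro ln_mono) auto
    finally show ?thesis
      using assms by (intro fslope_ge[of u "5.207" "4.875"]) (auto simp: power2_eq_square)
  qed
qed

section \<open>Sets of primes with few elements\<close>

text \<open>Monotonicity permits evaluation at a rational lower bound \<open>y\<close> of
  \<open>L\<close>, with \<open>z\<close> in place of \<open>ln y\<close>. The first hypothesis is a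
  rational way to guarantee \<open>exp 2 \<le> y\<close>.\<close>

lemma ratio_bound_ge:
  fixes y L z N :: real
  assumes "(1457 / 536) ^ 2 \<le> y" "y \<le> L" "ln y \<le> z" "N \<le> y / z + 2 * y / z\<^sup>2"
  shows "N \<le> ratio_bound L"
proof -
  have e: "exp 2 \<le> y" using exp_le_via[of 2 y] assms(1) by simp
  then have "y > 0" using less_le_trans[OF exp_gt_zero] by blast
  then have ly: "2 \<le> ln y" using e by (simp add: ln_ge_iff)
  note assms(4)
  also have "y / z + 2 * y / z\<^sup>2 \<le> ratio_bound y"
  proof -
    have z: "0 < ln y" "0 < z" using ly assms(3) by linarith+
    then have "(ln y)\<^sup>2 \<le> z\<^sup>2" using assms(3) by (intro power_mono) linarith+
    moreover have "0 < z * ln y" "0 < z\<^sup>2 * (ln y)\<^sup>2" using z by (auto simp only: zero_less_mult_iff zero_less_power)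
    ultimately show ?thesis
      unfolding ratio_bound_def using \<open>y > 0\<close> assms(3) by (intro add_mono divide_left_mono) simp_all
  qed
  also have "\<dots> \<le> ratio_bound L" using e assms(2) by (rule ratio_bound_mono)
  finally show ?thesis .
qed

lemma ratio_ln_ge:
  fixes y L z N :: real
  assumes "1457 / 536 \<le> y" "y \<le> L" "ln y \<le> z" "N * z \<le> 1.3841 * y" "0 \<le> N"
  shows "N \<le> 1.3841 * (L / ln L)"
proof -
  have e: "exp 1 \<le> y" using exp_1_bounds(2) assms(1) by linarith
  then have "y > 0" using less_le_trans[OF exp_gt_zero] by blast
  then have ly: "1 \<le> ln y" using e by (simp add: ln_ge_iff)
  have "N * ln y \<le> N * z" using assms by (intro mult_left_mono)
  then have "N \<le> 1.3841 * (y / ln y)" using ly assms(4) by (simp add: field_simps)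
  also have "\<dots> \<le> 1.3841 * (L / ln L)"
    using ratio_ln_mono[OF e assms(2)] by (intro mult_left_mono) auto
  finally show ?thesis .
qed

text \<open>Among sets of \<open>r\<close> primes the first \<open>r\<close> primes have the
  smallest product, so a numerical check at that primorial suffices. The extra 1 on the left is the
  one in the definition of \<open>kseq\<close>.\<close>

lemma ratio_bound_prime_set_small:
  assumes S: "finite S" "\<forall>p\<in>S. prime p" "card S = r" and "6 \<le> r" "r \<le> 11"
  shows "real r + 1 \<le> ratio_bound (prime_set_log S)"
proof -
  have "r = 6 \<or> r = 7 \<or> r = 8 \<or> r = 9 \<or> r = 10 \<or> r = 11" using assms by linarith
  then consider "r = 6" | "r = 7" | "r = 8" | "r = 9" | "r = 10" | "r = 11" by blast
  then show ?thesis
  proof cases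
    case 1
    have "10.309 \<le> theta 13"
      using ln_ge_via_exp[of "30030" 10 "0.309"] by (simp add: theta_small power_divide power2_eq_square power3_eq_cube)
    also have "\<dots> \<le> prime_set_log S"
      using S 1 card_primes_upto_small by (intro theta_le_prime_set_log) auto
    finally have y: "10.309 \<le> prime_set_log S" .
    have z: "ln 10.309 \<le> (2.334 :: real)"
      using ln_le_via_exp[of "10.309" 2 "0.334"] by (simp add: power_divide power2_eq_square power3_eq_cube)
    show ?thesis
      by (rule ratio_bound_ge[OF _ y z]) (use S 1  in \<open>simp_all add: power_divide power2_eq_square\<close>)
  next
    case 2
    have "13.143 \<le> theta 17"
      using ln_ge_via_exp[of "510510" 13 "0.143"] by (simp add: theta_small power_divide power2_eq_square power3_eq_cube)
    also have "\<dots> \<le> prime_set_log S"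
      using S 2 card_primes_upto_small by (intro theta_le_prime_set_log) auto
    finally have y: "13.143 \<le> prime_set_log S" .
    have z: "ln 13.143 \<le> (2.578 :: real)"
      using ln_le_via_exp[of "13.143" 3 "-0.422"] by (simp add: power_divide power2_eq_square power3_eq_cube)
    show ?thesis
      by (rule ratio_bound_ge[OF _ y z]) (use S 2  in \<open>simp_all add: power_divide power2_eq_square\<close>)
  next
    case 3
    have "16.087 \<le> theta 19"
      using ln_ge_via_exp[of "9699690" 16 "0.087"] by (simp add: theta_small power_divide power2_eq_square power3_eq_cube)
    also have "\<dots> \<le> prime_set_log S"
      using S 3 card_primes_upto_small by (intro theta_le_prime_set_log) auto
    finally have y: "16.087 \<le> prime_set_log S" .
    have z: "ln 16.087 \<le> (2.779 :: real)"
      using ln_le_via_exp[of "16.087" 3 "-0.221"] by (simp add: power_divide power2_eq_square power3_eq_cube)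
    show ?thesis
      by (rule ratio_bound_ge[OF _ y z]) (use S 3  in \<open>simp_all add: power_divide power2_eq_square\<close>)
  next
    case 4
    have "19.222 \<le> theta 23"
      using ln_ge_via_exp[of "223092870" 19 "0.222"] by (simp add: theta_small power_divide power2_eq_square power3_eq_cube)
    also have "\<dots> \<le> prime_set_log S"
      using S 4 card_primes_upto_small by (intro theta_le_prime_set_log) auto
    finally have y: "19.222 \<le> prime_set_log S" .
    have z: "ln 19.222 \<le> (2.957 :: real)"
      using ln_le_via_exp[of "19.222" 3 "-0.043"] by (simp add: power_divide power2_eq_square power3_eq_cube)
    show ?thesis
      by (rule ratio_bound_ge[OF _ y z]) (use S 4  in \<open>simp_all add: power_divide power2_eq_square\<close>)
  next
    case 5
    have "22.589 \<le> theta 29"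
      using ln_ge_via_exp[of "6469693230" 23 "-0.411"] by (simp add: theta_small power_divide power2_eq_square power3_eq_cube)
    also have "\<dots> \<le> prime_set_log S"
      using S 5 card_primes_upto_small by (intro theta_le_prime_set_log) auto
    finally have y: "22.589 \<le> prime_set_log S" .
    have z: "ln 22.589 \<le> (3.118 :: real)"
      using ln_le_via_exp[of "22.589" 3 "0.118"] by (simp add: power_divide power2_eq_square power3_eq_cube)
    show ?thesis
      by (rule ratio_bound_ge[OF _ y z]) (use S 5  in \<open>simp_all add: power_divide power2_eq_square\<close>)
  next
    case 6
    have "26.024 \<le> theta 31"
      using ln_ge_via_exp[of "200560490130" 26 "0.024"] by (simp add: theta_small power_divide power2_eq_square power3_eq_cube)
    also have "\<dots> \<le> prime_set_log S"
      using S 6 card_primes_upto_small by (intro theta_le_prime_set_log) auto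
    finally have y: "26.024 \<le> prime_set_log S" .
    have z: "ln 26.024 \<le> (3.26 :: real)"
      using ln_le_via_exp[of "26.024" 3 "0.26"] by (simp add: power_divide power2_eq_square power3_eq_cube)
    show ?thesis
      by (rule ratio_bound_ge[OF _ y z]) (use S 6  in \<open>simp_all add: power_divide power2_eq_square\<close>)
  qed
qed

lemma ratio_ln_prime_set_small:
  assumes S: "finite S" "\<forall>p\<in>S. prime p" "card S = r" and "4 \<le> r" "r \<le> 9"
  shows "real r \<le> 1.3841 * (prime_set_log S / ln (prime_set_log S))"
proof -
  have "r = 4 \<or> r = 5 \<or> r = 6 \<or> r = 7 \<or> r = 8 \<or> r = 9" using assms by linarith
  then consider "r = 4" | "r = 5" | "r = 6" | "r = 7" | "r = 8" | "r = 9" by blast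
  then show ?thesis
  proof cases
    case 1
    have "5.346 \<le> theta 7"
      using ln_ge_via_exp[of "210" 5 "0.346"] by (simp add: theta_small power_divide power2_eq_square power3_eq_cube)
    also have "\<dots> \<le> prime_set_log S"
      using S 1 card_primes_upto_small by (intro theta_le_prime_set_log) auto
    finally have y: "5.346 \<le> prime_set_log S" .
    have z: "ln 5.346 \<le> (1.677 :: real)"
      using ln_le_via_exp[of "5.346" 2 "-0.323"] by (simp add: power_divide power2_eq_square power3_eq_cube)
    show ?thesis
      by (rule ratio_ln_ge[OF _ y z]) (use S 1  in simp_all)
  next
    case 2
    have "7.744 \<le> theta 11"
      using ln_ge_via_exp[of "2310" 8 "-0.256"] by (simp add: theta_small power_divide power2_eq_square power3_eq_cube)
    also have "\<dots> \<le> prime_set_log S"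
      using S 2 card_primes_upto_small by (intro theta_le_prime_set_log) auto
    finally have y: "7.744 \<le> prime_set_log S" .
    have z: "ln 7.744 \<le> (2.047 :: real)"
      using ln_le_via_exp[of "7.744" 2 "0.047"] by (simp add: power_divide power2_eq_square power3_eq_cube)
    show ?thesis
      by (rule ratio_ln_ge[OF _ y z]) (use S 2  in simp_all)
  next
    case 3
    have "10.309 \<le> theta 13"
      using ln_ge_via_exp[of "30030" 10 "0.309"] by (simp add: theta_small power_divide power2_eq_square power3_eq_cube)
    also have "\<dots> \<le> prime_set_log S"
      using S 3 card_primes_upto_small by (intro theta_le_prime_set_log) auto
    finally have y: "10.309 \<le> prime_set_log S" .
    have z: "ln 10.309 \<le> (2.334 :: real)"
      using ln_le_via_exp[of "10.309" 2 "0.334"] by (simp add: power_divide power2_eq_square power3_eq_cube)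
    show ?thesis
      by (rule ratio_ln_ge[OF _ y z]) (use S 3  in simp_all)
  next
    case 4
    have "13.143 \<le> theta 17"
      using ln_ge_via_exp[of "510510" 13 "0.143"] by (simp add: theta_small power_divide power2_eq_square power3_eq_cube)
    also have "\<dots> \<le> prime_set_log S"
      using S 4 card_primes_upto_small by (intro theta_le_prime_set_log) auto
    finally have y: "13.143 \<le> prime_set_log S" .
    have z: "ln 13.143 \<le> (2.578 :: real)"
      using ln_le_via_exp[of "13.143" 3 "-0.422"] by (simp add: power_divide power2_eq_square power3_eq_cube)
    show ?thesis
      by (rule ratio_ln_ge[OF _ y z]) (use S 4  in simp_all)
  next
    case 5
    have "16.087 \<le> theta 19"
      using ln_ge_via_exp[of "9699690" 16 "0.087"] by (simp add: theta_small power_divide power2_eq_square power3_eq_cube)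
    also have "\<dots> \<le> prime_set_log S"
      using S 5 card_primes_upto_small by (intro theta_le_prime_set_log) auto
    finally have y: "16.087 \<le> prime_set_log S" .
    have z: "ln 16.087 \<le> (2.779 :: real)"
      using ln_le_via_exp[of "16.087" 3 "-0.221"] by (simp add: power_divide power2_eq_square power3_eq_cube)
    show ?thesis
      by (rule ratio_ln_ge[OF _ y z]) (use S 5  in simp_all)
  next
    case 6
    \<comment> \<open>This is the nearly sharp case and needs four decimals:
      \<open>9 * 2.9562 = 26.6058\<close>, while \<open>1.3841 * 19.2229\<close> is about
      26.6064.\<close>
    have "19.2229 \<le> theta 23"
      using ln_ge_via_exp[of "223092870" 19 "0.2229"] by (simp add: theta_small power_divide power2_eq_square power3_eq_cube)
    also have "\<dots> \<le> prime_set_log S"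
      using S 6 card_primes_upto_small by (intro theta_le_prime_set_log) auto
    finally have y: "19.2229 \<le> prime_set_log S" .
    have z: "ln 19.2229 \<le> (2.9562 :: real)"
      using ln_le_via_exp[of "19.2229" 3 "-0.0438"] by (simp add: power_divide power2_eq_square power3_eq_cube)
    show ?thesis
      by (rule ratio_ln_ge[OF _ y z]) (use S 6  in simp_all)
  qed
qed

section \<open>Sets of primes of arbitrary size\<close>

lemma theta_23_31_ge: "19.2 \<le> theta 23" "26 \<le> theta 31"
  using ln_ge_via_exp[of 223092870 19 "0.2"] ln_ge_via_exp[of 200560490130 26 0]
  by (simp_all add: theta_small power_divide power2_eq_square power3_eq_cube)

text \<open>Up to eleven primes the values are explicit. After that, a new largest prime is at least
  37 and raises \<open>ratio_bound\<close> by at least 1. With the tabulated bounds the slope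
  criterion fails at 29 and 31 and first holds at 37, hence the start at eleven primes.\<close>

lemma ratio_bound_prime_set:
  assumes S: "finite S" "\<forall>p\<in>S. prime p" "6 \<le> card S"
  shows "real (card S) + 1 \<le> ratio_bound (prime_set_log S)"
proof (cases "card S \<le> 11")
  case True
  with ratio_bound_prime_set_small[OF S(1,2) refl S(3)] show ?thesis by simp
next
  case False
  then have "card (primes_upto 31) \<le> card S" by (simp add: card_primes_upto_small)
  with S(1,2) show ?thesis
  proof (induction rule: prime_set_induct)
    case (base S)
    then show ?case
      using ratio_bound_prime_set_small[of S 11] by (simp add: card_primes_upto_small)
  next
    case (step r L p)
    have L: "26 \<le> L" using step theta_23_31_ge by linarith
    have "\<not> prime (32::nat)" "\<not> prime (33::nat)" "\<not> prime (34::nat)" "\<not> prime (35::nat)" "\<not> prime (36::nat)"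
      by simp_all
    then have "p \<notin> {32, 33, 34, 35, 36}" using step.hyps(1) by auto
    then have p: "37 \<le> p" using step.hyps(2) by auto
    have "ratio_bound L + 1 \<le> ratio_bound (L + ln (real p))"
    proof (rule ratio_bound_step)
      fix u assume u: "3 \<le> u" "u \<le> ln (L + ln (real p))"
      have "ln (L + ln (real p)) \<le> ln (theta p)"
        using step.hyps L p by (intro ln_mono) (auto intro!: add_pos_nonneg)
      with u show "1 \<le> ln (real p) * (1 / u + 1 / u\<^sup>2 - 4 / u ^ 3)"
        by (intro gslope_prime[OF p]) auto
    qed (use L p in auto)
    with step show ?case by simp
  qed
qed

text \<open>While \<open>ln L\<close> is at most 5.207, induction from the first nine primes works;
  beyond that the claim follows from \<open>ratio_bound_prime_set\<close>.\<close>

lemma ratio_ln_prime_set: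
  assumes S: "finite S" "\<forall>p\<in>S. prime p" "4 \<le> card S"
  shows "real (card S) \<le> 1.3841 * (prime_set_log S / ln (prime_set_log S))"
proof (cases "card S \<le> 9")
  case True
  with ratio_ln_prime_set_small[OF S(1,2) refl S(3)] show ?thesis by simp
next
  case False
  then have card: "card (primes_upto 23) \<le> card S" by (simp add: card_primes_upto_small)
  \<comment> \<open>The cap is a premise inside the induction formula; it passes down to the smaller
    set because the logarithmic weight decreases.\<close>
  have ind: "ln (prime_set_log S) \<le> 5.207 \<longrightarrow>
      real (card S) \<le> 1.3841 * (prime_set_log S / ln (prime_set_log S))"
    using S(1,2) card
  proof (induction rule: prime_set_induct)
    case (base S)
    then show ?case
      using ratio_ln_prime_set_small[of S 9] by (simp add: card_primes_upto_small)
  next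
    case (step r L p)
    have L: "19.2 \<le> L" using step theta_23_31_ge by linarith
    have "\<not> prime (24::nat)" "\<not> prime (25::nat)" "\<not> prime (26::nat)" "\<not> prime (27::nat)" "\<not> prime (28::nat)"
      by simp_all
    then have "p \<notin> {24, 25, 26, 27, 28}" using step.hyps(1) by auto
    then have p: "29 \<le> p" using step.hyps(2) by auto
    then have lp: "0 < ln (real p)" by simp
    show ?case
    proof
      assume le: "ln (L + ln (real p)) \<le> 5.207"
      have "ln L \<le> ln (L + ln (real p))" using L lp by (intro ln_mono) auto
      with le step have IH: "real r \<le> 1.3841 * (L / ln L)" by auto
      have "exp (real 2) \<le> L" by (rule exp_le_via) (use L in \<open>simp add: power_divide\<close>)
      then obtain u where u: "ln L \<le> u" "u \<le> ln (L + ln (real p))" "2 \<le> u"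
        "(L + ln (real p)) / ln (L + ln (real p)) - L / ln L = ln (real p) * (1 / u - 1 / u\<^sup>2)"
        using ratio_ln_MVT[of L "ln (real p)"] lp by auto
      have "0 < L + ln (real p)" using L lp by linarith
      with step.hyps have "ln (L + ln (real p)) \<le> ln (theta p)" by (intro ln_mono)
      then have "1 \<le> 1.3841 * ln (real p) * (1 / u - 1 / u\<^sup>2)"
        using u le by (intro fslope_prime[OF p]) auto
      then have "1 \<le> 1.3841 * ((L + ln (real p)) / ln (L + ln (real p)) - L / ln L)"
        unfolding u(4) by (simp only: mult.assoc)
      with IH show "real (Suc r) \<le> 1.3841 * ((L + ln (real p)) / ln (L + ln (real p)))"
        by (simp add: right_diff_distrib)
    qed
  qed
  show ?thesis
  proof (cases "ln (prime_set_log S) \<le> 5.207")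
    case True
    with ind show ?thesis by simp
  next
    case False
    define L where "L = prime_set_log S"
    have u: "5.207 < ln L" using False by (simp add: L_def)
    have "19.2 \<le> L"
      unfolding L_def using theta_le_prime_set_log[OF S(1,2) card] theta_23_31_ge by linarith
    have "real (card S) + 1 \<le> ratio_bound L"
      unfolding L_def using S card by (intro ratio_bound_prime_set) (auto simp: card_primes_upto_small)
    also have "ratio_bound L = (1 + 2 / ln L) * (L / ln L)"
      using u by (simp add: ratio_bound_def power2_eq_square field_simps)
    also have "\<dots> \<le> 1.3841 * (L / ln L)"
      \<comment> \<open>Here \<open>1 + 2 / 5.207 \<le> 1.3841\<close> is used.\<close>
      using u \<open>19.2 \<le> L\<close> by (intro mult_right_mono) (auto simp: field_simps)
    finally show ?thesis by (simp add: L_def)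
  qed
qed

section \<open>Products of initial segments of the primes\<close>

text \<open>With \<open>s = sqrt n\<close> and a linear bound for \<open>ln s\<close>,
  \<open>theta_ge\<close> becomes a quadratic inequality in \<open>s\<close>. The summand 1 allows
  the use at \<open>n = p - 1\<close>.\<close>

lemma theta_ge_large:
  assumes "100 \<le> n"
  shows "real n + 1 \<le> exp 1 * theta n"
proof -
  define s where "s = sqrt (real n)"
  have s: "s \<ge> 10" unfolding s_def using assms by (intro real_le_rsqrt) simp
  have n: "real n = s * s" by (simp add: s_def)
  have sqrt_n: "sqrt (s * s) = s" using s by simp
  \<comment> \<open>The tangent of \<open>ln\<close> at 10, the smallest admissible
    \<open>s\<close>.\<close>
  have "ln (s / 10) \<le> s / 10 - 1" using s by (intro ln_le_minus_one) simp
  moreover have "ln s = ln (s / 10) + ln 10" using s by (simp add: ln_div)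
  moreover have "ln 10 \<le> (288 / 125 :: real)"
    using ln_le_via_exp[of 10 2 "0.304"] by (simp add: power_divide power2_eq_square power3_eq_cube)
  ultimately have lns: "ln s \<le> 163 / 125 + s / 10" by linarith
  have l2: "69 / 100 \<le> ln (2 :: real)"
    using ln_ge_via_exp[of 2 1 "-0.31"] by (simp add: power_divide power2_eq_square power3_eq_cube)
  have "(s * s - 2) * (69 / 100) \<le> (s * s - 2) * ln 2"
    using l2 s mult_mono[of 10 s 10 s] by (intro mult_left_mono) auto
  moreover have "(s + 1) * ln s \<le> (s + 1) * (163 / 125 + s / 10)"
    using lns s by (intro mult_left_mono) auto
  moreover have "(s * s - 2) * ln 2 - (s + 1) / 2 * ln (s * s) \<le> theta n"
    using theta_ge[of n] assms by (simp add: n sqrt_n abs_of_nonneg[OF order_trans[OF _ s]])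
  moreover have "ln (s * s) = 2 * ln s" using s by (simp add: ln_mult_pos)
  ultimately have "(s * s - 2) * (69 / 100) - (s + 1) * (163 / 125 + s / 10) \<le> theta n"
    by (simp add: field_simps)
  moreover have "(s * s - 2) * (69 / 100) - (s + 1) * (163 / 125 + s / 10) = 59 / 100 * (s * s) - 351 / 250 * s - 671 / 250"
    by (simp add: field_simps)
  moreover have "10 * s \<le> s * s" using s by (intro mult_right_mono) auto
  \<comment> \<open>The coefficient 37/100 still satisfies \<open>2.71 * 0.37 > 1\<close>. At
    \<open>s = 10\<close> the two sides are 42.276 and 42, so the threshold 100 for \<open>n\<close>
    leaves little room.\<close>
  ultimately have t: "37 / 100 * (s * s) + 5 \<le> theta n" using s by linarith
  have "271 / 100 * (37 / 100 * (s * s) + 5) \<le> exp 1 * theta n"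
    using t exp_1_bounds(1) s by (intro mult_mono) auto
  moreover have "x + 1 \<le> 271 / 100 * (37 / 100 * x + 5)" if "0 \<le> x" for x :: real
    using that by simp
  from this[of "s * s"] have "s * s + 1 \<le> 271 / 100 * (37 / 100 * (s * s) + 5)" by simp
  ultimately show ?thesis unfolding n by (rule order_trans[rotated])
qed

text \<open>In the form \<open>ln p \<le> 1 + ln (theta (p - 1))\<close> this limits the logarithm
  added by a new prime.\<close>

lemma prime_le_theta:
  assumes "12 \<le> p"
  shows "real p \<le> exp 1 * theta (p - 1)"
proof -
  have bound: "real p \<le> exp 1 * theta (p - 1)"
    if "a \<le> p - 1" "B \<le> theta a" "real p \<le> 271 / 100 * B" "0 \<le> B" for a B
  proof -
    have "271 / 100 * B \<le> exp 1 * theta (p - 1)"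
      using theta_mono[OF that(1)] that exp_1_bounds(1) by (intro mult_mono) auto
    with that show ?thesis by linarith
  qed
  \<comment> \<open>The ranges end where 2.71 times the lower bound for \<open>theta 11\<close>,
    \<open>theta 19\<close> and \<open>theta 43\<close>, respectively, stops sufficing.\<close>
  consider "p \<le> 20" | "20 \<le> p" "p \<le> 43" | "44 \<le> p" "p \<le> 100" | "101 \<le> p" by linarith
  then show ?thesis
  proof cases
    case 1
    have "387 / 50 \<le> theta 11"
      using ln_ge_via_exp[of 2310 8 "-0.26"]
      by (simp add: theta_small power_divide power2_eq_square power3_eq_cube)
    then show ?thesis using 1 assms by (intro bound[of 11 "387 / 50"]) auto
  next
    case 2
    have "16 \<le> theta 19"
      using ln_ge_via_exp[of 9699690 16 0]
      by (simp add: theta_small power_divide)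
    then show ?thesis using 2 by (intro bound[of 19 16]) auto
  next
    case 3
    have "37 \<le> theta 43"
      using ln_ge_via_exp[of 13082761331670030 37 0]
      by (simp add: theta_small power_divide)
    then show ?thesis using 3 by (intro bound[of 43 37]) auto
  next
    case 4
    then show ?thesis using theta_ge_large[of "p - 1"] by (simp add: of_nat_diff)
  qed
qed

text \<open>A new prime raises the right side by 1. The left side grows by
  \<open>d * (1 / u - 1 / u\<^sup>2)\<close> with \<open>d \<le> 1 + u\<close>, hence by at most
  \<open>1 - 1 / u\<^sup>2\<close>.\<close>

lemma theta_over_ln_theta_less:
  assumes "11 \<le> x"
  shows "theta x / ln (theta x) < real (card (primes_upto x)) + 1"
  using assms
proof (induction x rule: dec_induct)
  case base
  have "theta 11 \<le> 7.76"
    using ln_le_via_exp[of 2310 8 "-0.24"]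
    by (simp add: theta_small power_divide power2_eq_square power3_eq_cube)
  moreover have "7.7 \<le> theta 11"
    using ln_ge_via_exp[of 2310 8 "-0.3"]
    by (simp add: theta_small power_divide power2_eq_square power3_eq_cube)
  then have "ln 7.7 \<le> ln (theta 11)" by (intro ln_mono) auto
  moreover have "2 \<le> ln (7.7 :: real)"
    using ln_ge_via_exp[of "7.7" 2 0] by (simp add: power_divide)
  ultimately show ?case by (simp add: card_primes_upto_small field_simps)
next
  case (step x)
  show ?case
  proof (cases "prime (Suc x)")
    case False
    with step show ?thesis by (simp add: theta_Suc primes_upto_Suc)
  next
    case True
    define L where "L = theta x"
    define d where "d = ln (real (Suc x))"
    have "7.7 \<le> theta 11"
      using ln_ge_via_exp[of 2310 8 "-0.3"]
      by (simp add: theta_small power_divide power2_eq_square power3_eq_cube)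
    also have "\<dots> \<le> L" unfolding L_def using step by (intro theta_mono) auto
    finally have L: "7.7 \<le> L" .
    have "exp (real 2) \<le> L" by (rule exp_le_via) (use L in \<open>simp add: power_divide\<close>)
    moreover have "0 < d" unfolding d_def using step by simp
    ultimately obtain u where u: "ln L \<le> u" "2 \<le> u"
      "(L + d) / ln (L + d) - L / ln L = d * (1 / u - 1 / u\<^sup>2)"
      using ratio_ln_MVT[of L d] by auto
    have "d \<le> ln (exp 1 * L)"
      unfolding d_def L_def using prime_le_theta[of "Suc x"] step by (intro ln_mono) auto
    also have "\<dots> = 1 + ln L" using L by (simp add: ln_mult_pos)
    finally have "d \<le> 1 + u" using u by linarith
    then have "d * (1 / u - 1 / u\<^sup>2) \<le> (1 + u) * (1 / u - 1 / u\<^sup>2)"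
      using u(2) by (intro mult_right_mono) (auto simp: field_simps power2_eq_square)
    also have "\<dots> = 1 - 1 / u\<^sup>2"
      using u(2) by (simp add: field_simps power2_eq_square)
    also have "\<dots> < 1" using u(2) by simp
    finally have "(L + d) / ln (L + d) < L / ln L + 1" using u(3) by linarith
    moreover have "theta (Suc x) = L + d" using True by (simp add: theta_Suc L_def d_def)
    moreover have "card (primes_upto (Suc x)) = Suc (card (primes_upto x))"
      using True by (simp add: primes_upto_Suc) (simp add: primes_upto_def)
    ultimately show ?thesis using step.IH by (simp add: L_def)
  qed
qed

section \<open>Elementary inequalities for small \<open>n\<close>\<close>

text \<open>The range contains the interval from \<open>ln 6\<close> to \<open>ln 210\<close>. On
  each of four pieces, four times the logarithm of the left end exceeds the right end.\<close>

lemma less_four_ln: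
  fixes L :: real
  assumes "1.79 \<le> L" "L \<le> 5.35"
  shows "L < 4 * ln L"
proof -
  have ge: "L < 4 * ln L" if "a \<le> L" "c \<le> ln a" "L < 4 * c" "0 < a" for a c :: real
    using ln_mono[of a L] that by linarith
  consider "L \<le> 11 / 5" | "11 / 5 \<le> L" "L \<le> 31 / 10" | "31 / 10 \<le> L" "L \<le> 9 / 2" | "9 / 2 \<le> L" by linarith
  then show ?thesis
  proof cases
    case 1
    then show ?thesis
      using assms ln_ge_via_exp[of "1.79" 1 "-0.43"]
      by (intro ge[of "1.79" "0.57"]) (simp_all add: power_divide power2_eq_square power3_eq_cube)
  next
    case 2
    then show ?thesis
      using ln_ge_via_exp[of "2.2" 1 "-0.22"]
      by (intro ge[of "2.2" "0.78"]) (simp_all add: power_divide power2_eq_square power3_eq_cube)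
  next
    case 3
    then show ?thesis
      using ln_ge_via_exp[of "3.1" 1 "0.13"]
      by (intro ge[of "3.1" "1.13"]) (simp_all add: power_divide power2_eq_square power3_eq_cube)
  next
    case 4
    then show ?thesis
      using assms ln_ge_via_exp[of "4.5" 1 "0.45"]
      by (intro ge[of "4.5" "1.45"]) (simp_all add: power_divide power2_eq_square power3_eq_cube)
  qed
qed

text \<open>Covers at most five primes whatever the size of \<open>L\<close>. With
  \<open>u = ln L\<close> the claim is \<open>6 * u\<^sup>2 \<le> exp u * (u + 2)\<close>; replacing
  \<open>exp u\<close> by its cubic leaves a polynomial that is visibly nonnegative once squares are
  completed.\<close>

lemma six_le_ratio_bound:
  assumes "1 < L"
  shows "6 \<le> ratio_bound L"
proof -
  define u where "u = ln L"
  have u: "0 < u" "L = exp u" using assms by (auto simp: u_def)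
  have "(1 + u + u\<^sup>2 / 2 + u ^ 3 / 6) * (u + 2) - 6 * u\<^sup>2
      = ((u\<^sup>2 - 3)\<^sup>2 + u * (5 * (u - 9 / 5)\<^sup>2 + 9 / 5) + 3) / 6"
    by (simp add: field_simps power2_eq_square power3_eq_cube)
  also have "\<dots> \<ge> 0" using u(1) by (intro divide_nonneg_nonneg add_nonneg_nonneg mult_nonneg_nonneg) auto
  finally have "6 * u\<^sup>2 \<le> (1 + u + u\<^sup>2 / 2 + u ^ 3 / 6) * (u + 2)" by simp
  also have "\<dots> \<le> L * (u + 2)"
    using exp_ge_cubic[of u] u by (intro mult_right_mono) auto
  finally show ?thesis
    unfolding ratio_bound_def u_def[symmetric] using u(1) by (simp add: field_simps power2_eq_square)
qed

text \<open>Covers at most three primes: \<open>L / ln L\<close> is at least e for every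
  \<open>L > 1\<close>, because \<open>exp (u - 1) \<ge> u\<close>.\<close>

lemma three_le_ratio_ln:
  fixes L :: real
  assumes "1 < L"
  shows "3 \<le> 1.3841 * (L / ln L)"
proof -
  define u where "u = ln L"
  have u: "0 < u" "L = exp u" using assms by (auto simp: u_def)
  have "271 / 100 * u \<le> exp 1 * exp (u - 1)"
    using exp_1_bounds(1) exp_ge_add_one_self[of "u - 1"] u by (intro mult_mono) auto
  also have "\<dots> = L" using u by (simp flip: exp_add)
  finally show ?thesis unfolding u_def[symmetric] using u(1) by (simp add: field_simps)
qed

text \<open>The error term absorbs the summand 1 in \<open>ratio_ln_less_kseq\<close>.\<close>

lemma two_ratio_ln_square_ge_1:
  fixes L :: real
  assumes "1 < L"
  shows "1 \<le> 2 * L / (ln L)\<^sup>2"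
proof -
  define u where "u = ln L"
  have u: "0 < u" "L = exp u" using assms by (auto simp: u_def)
  have "0 \<le> u ^ 3" using u by simp
  then have "u\<^sup>2 / 2 \<le> L" using exp_ge_cubic[of u] u by linarith
  then show ?thesis unfolding u_def[symmetric] using u(1) by (simp add: field_simps)
qed

section \<open>The multiplicity of the eigenvalue one\<close>

text \<open>Take the prime factors of some \<open>m \<le> n\<close> at which \<open>omega\<close> is
  maximal; their product divides \<open>m\<close>.\<close>

lemma kseq_eq_card_primes:
  assumes "n \<ge> 2"
  obtains S where "finite S" "\<forall>p\<in>S. prime p" "kseq n = card S + 1" "prime_set_log S \<le> ln (real n)"
proof -
  obtain m where m: "2 \<le> m" "m \<le> n" "kseq n = omega m + 1"
    by (rule kseq_eq_omega[OF assms])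
  let ?S = "prime_factors m"
  have pos: "0 < p" if "p \<in> ?S" for p
    using that by (simp add: in_prime_factors_iff prime_gt_0_nat)
  have "\<Prod>?S dvd m"
    by (rule prod_primes_dvd) (auto simp: in_prime_factors_iff)
  then have "\<Prod>?S \<le> m" using m by (intro dvd_imp_le) auto
  moreover have "0 < \<Prod>?S" using pos by (intro prod_pos) auto
  ultimately have "ln (real (\<Prod>?S)) \<le> ln (real n)"
    using m by (intro ln_mono) (simp_all del: of_nat_prod)
  then have "prime_set_log ?S \<le> ln (real n)"
    unfolding prime_set_log_def using sum_ln_eq_ln_prod[of ?S] pos by simp
  then show ?thesis
    using m(3) by (intro that[of ?S]) (auto simp: omega_def in_prime_factors_iff)
qed

lemma ln_gt_1:
  assumes "3 \<le> n"
  shows "1 < ln (real n)"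
proof -
  have "1 + 1 / 20 \<le> ln (3 :: real)"
    using ln_ge_via_exp[of 3 1 "1 / 20"] by (simp add: power_divide power2_eq_square power3_eq_cube)
  also have "\<dots> \<le> ln (real n)" using assms by (intro ln_mono) auto
  finally show ?thesis by simp
qed

lemma kseq_le_ratio_bound:
  assumes "3 \<le> n"
  shows "real (kseq n) \<le> ratio_bound (ln (real n))"
proof -
  obtain S where S: "finite S" "\<forall>p\<in>S. prime p" "kseq n = card S + 1" "prime_set_log S \<le> ln (real n)"
    using kseq_eq_card_primes[of n] assms by auto
  show ?thesis
  proof (cases "card S \<le> 5")
    case True
    with six_le_ratio_bound[OF ln_gt_1[OF assms]] S(3) show ?thesis by simp
  next
    case False
    have "10 \<le> theta 13"
      using ln_ge_via_exp[of 30030 10 0] by (simp add: theta_small power_divide)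
    also have "\<dots> \<le> prime_set_log S"
      using S(1,2) False by (intro theta_le_prime_set_log) (auto simp: card_primes_upto_small)
    finally have "(1457 / 536) ^ 2 \<le> prime_set_log S" by (simp add: power_divide)
    then have "exp 2 \<le> prime_set_log S" using exp_le_via[of 2 "prime_set_log S"] by simp
    then have "ratio_bound (prime_set_log S) \<le> ratio_bound (ln (real n))" using S(4) by (rule ratio_bound_mono)
    moreover have "real (card S) + 1 \<le> ratio_bound (prime_set_log S)"
      using S False by (intro ratio_bound_prime_set) auto
    ultimately show ?thesis using S(3) by simp
  qed
qed

lemma kseq_le_ratio_ln:
  assumes "3 \<le> n"
  shows "real (kseq n) \<le> 1.3841 * (ln (real n) / ln (ln (real n))) + 1"
proof -
  obtain S where S: "finite S" "\<forall>p\<in>S. prime p" "kseq n = card S + 1" "prime_set_log S \<le> ln (real n)"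
    using kseq_eq_card_primes[of n] assms by auto
  have "real (card S) \<le> 1.3841 * (ln (real n) / ln (ln (real n)))"
  proof (cases "card S \<le> 3")
    case True
    then have "real (card S) \<le> 3" by simp
    with three_le_ratio_ln[OF ln_gt_1[OF assms]] show ?thesis by (rule order_trans[rotated])
  next
    case False
    have "5 \<le> theta 7"
      using ln_ge_via_exp[of 210 5 0] by (simp add: theta_small power_divide)
    also have "\<dots> \<le> prime_set_log S"
      using S(1,2) False by (intro theta_le_prime_set_log) (auto simp: card_primes_upto_small)
    finally have "exp 1 \<le> prime_set_log S" using exp_1_bounds(2) by linarith
    then have "prime_set_log S / ln (prime_set_log S) \<le> ln (real n) / ln (ln (real n))"
      using S(4) by (rule ratio_ln_mono)
    then have "1.3841 * (prime_set_log S / ln (prime_set_log S)) \<le> 1.3841 * (ln (real n) / ln (ln (real n)))"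
      by (intro mult_left_mono) auto
    moreover have "real (card S) \<le> 1.3841 * (prime_set_log S / ln (prime_set_log S))"
      using S False by (intro ratio_ln_prime_set) auto
    ultimately show ?thesis by (rule order_trans[rotated])
  qed
  with S(3) show ?thesis by simp
qed

lemma omega_prod_primes_upto: "omega (\<Prod>(primes_upto x)) = card (primes_upto x)"
proof -
  have "\<Prod>(primes_upto x) \<noteq> 0"
    by (auto simp: primes_upto_def)
  moreover have "p dvd \<Prod>(primes_upto x) \<longleftrightarrow> p \<in> primes_upto x" if pr: "prime p" for p
  proof
    assume "p dvd \<Prod>(primes_upto x)"
    then obtain q where "q \<in> primes_upto x" "p dvd q"
      using pr prime_dvd_prod_iff[of "primes_upto x" p "\<lambda>q. q"] by auto
    then show "p \<in> primes_upto x"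
      using pr primes_dvd_imp_eq[of p q] by (auto simp: primes_upto_def)
  qed (auto intro: dvd_prodI[of _ _ "\<lambda>q. q"])
  ultimately have "prime_factors (\<Prod>(primes_upto x)) = primes_upto x"
    by (auto simp: in_prime_factors_iff primes_upto_def)
  then show ?thesis by (simp add: omega_def)
qed

text \<open>Let \<open>y\<close> be the first argument with \<open>theta y > ln n\<close>. It is
  prime, and the product of the primes below it is at most \<open>n\<close>, so
  \<open>kseq n\<close> is at least the number of primes up to \<open>y\<close>. Monotonicity moves
  the estimate of \<open>theta_over_ln_theta_less\<close> from \<open>theta y\<close> down to
  \<open>ln n\<close>.\<close>

lemma ratio_ln_less_kseq:
  assumes "6 \<le> n"
  shows "ln (real n) / ln (ln (real n)) < real (kseq n) + 1"
proof -
  define L where "L = ln (real n)"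
  obtain p where p: "prime p" "n < p" using bigger_prime by blast
  have "L < ln (real p)" unfolding L_def using assms p by simp
  also have "\<dots> \<le> theta p"
    unfolding theta_def using p by (intro member_le_sum) (auto simp: primes_upto_def ln_prime_nonneg)
  finally have "\<exists>y. L < theta y" by blast
  define y where "y = (LEAST y. L < theta y)"
  have y: "L < theta y" unfolding y_def using \<open>\<exists>y. L < theta y\<close> by (rule LeastI_ex)
  have least: "theta x \<le> L" if "x < y" for x
    using not_less_Least[of x "\<lambda>y. L < theta y"] that unfolding y_def by (simp add: not_less)
  have L6: "theta 3 \<le> L" unfolding L_def theta_small using assms by (intro ln_mono) auto
  have "3 < y"
  proof (rule ccontr)
    assume "\<not> 3 < y"
    then have "theta y \<le> theta 3" by (intro theta_mono) simp
    with y L6 show False by simp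
  qed
  then obtain x where x: "y = Suc x" "3 \<le> x" by (cases y) auto
  have "prime y"
  proof (rule ccontr)
    assume "\<not> prime y"
    then have "theta y = theta x" using x by (simp add: theta_Suc)
    with y least[of x] x show False by simp
  qed
  have pos: "0 < q" if "q \<in> primes_upto x" for q
    using that by (simp add: primes_upto_def prime_gt_0_nat)
  have cy: "card (primes_upto y) = card (primes_upto x) + 1"
    using \<open>prime y\<close> x by (simp add: primes_upto_Suc) (simp add: primes_upto_def)
  have "card (primes_upto 3) \<le> card (primes_upto x)"
    using x by (intro card_mono) (auto simp: primes_upto_def)
  then have c2: "2 \<le> card (primes_upto x)" by (simp add: card_primes_upto)
  \<comment> \<open>The product of the primes up to \<open>x = y - 1\<close> lacks only the prime
    \<open>y\<close>; the summand 1 in \<open>kseq\<close> makes up for it.\<close>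
  have k: "card (primes_upto y) \<le> kseq n"
  proof -
    let ?m = "\<Prod>(primes_upto x)"
    have "theta x = ln (real ?m)"
      unfolding theta_def by (rule sum_ln_eq_ln_prod) (rule pos)
    then have "ln (real ?m) \<le> ln (real n)" using least[of x] x by (simp add: L_def)
    moreover have m0: "0 < ?m" using pos by (intro prod_pos) auto
    ultimately have "real ?m \<le> real n" using assms by (simp del: of_nat_prod)
    then have "?m \<le> n" by (simp only: of_nat_le_iff)
    moreover have "?m \<noteq> 1"
      using omega_prod_primes_upto[of x] c2 by (auto simp: omega_def)
    ultimately show ?thesis
      using omega_le_kseq[of ?m n] omega_prod_primes_upto[of x] cy m0 by simp
  qed
  have "L / ln L < real (card (primes_upto y)) + 1"
  proof (cases "11 \<le> y")
    case True
    have "5 \<le> theta 7"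
      using ln_ge_via_exp[of 210 5 0] by (simp add: theta_small power_divide)
    also have "\<dots> \<le> L" using True by (intro least) simp
    finally have "exp 1 \<le> L" using exp_1_bounds(2) by linarith
    then have "L / ln L \<le> theta y / ln (theta y)" using y by (intro ratio_ln_mono) auto
    also have "\<dots> < real (card (primes_upto y)) + 1"
      using True by (rule theta_over_ln_theta_less)
    finally show ?thesis .
  next
    case False
    \<comment> \<open>Only 5 and 7 survive. Then \<open>L\<close> lies between \<open>ln 6\<close>
      and \<open>ln 210\<close>, the quotient is below 4, and there are at least three primes up to
      \<open>y\<close>.\<close>
    then have "y \<in> {4, 5, 6, 7, 8, 9, 10}" using \<open>3 < y\<close> by auto
    moreover have "\<not> prime (8::nat)" "\<not> prime (9::nat)" "\<not> prime (10::nat)" by simp_all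
    ultimately have "y \<le> 7" using \<open>prime y\<close> by auto
    then have "theta y \<le> theta 7" by (rule theta_mono)
    moreover have "theta 7 \<le> 5.35"
      using ln_le_via_exp[of 210 5 "0.35"]
      by (simp add: theta_small power_divide power2_eq_square power3_eq_cube)
    ultimately have "L \<le> 5.35" using y by linarith
    moreover have "1.79 \<le> theta 3"
      using ln_ge_via_exp[of 6 2 "-0.21"]
      by (simp add: theta_small power_divide power2_eq_square power3_eq_cube)
    then have "1.79 \<le> L" using L6 by (rule order_trans)
    ultimately have "L < 4 * ln L" by (intro less_four_ln)
    moreover have "1 < L" unfolding L_def using assms by (intro ln_gt_1) simp
    then have "0 < ln L" by simp
    ultimately have "L / ln L < 4" by (simp add: field_simps)
    then show ?thesis using c2 cy by simp
  qed
  then show ?thesis using k unfolding L_def by simp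
qed

text \<open>For \<open>n < 6\<close> one has \<open>ln L \<le> 1\<close>, so the left side is not
  positive; for larger \<open>n\<close> the error term outweighs the loss of 1.\<close>

lemma kseq_ge_ratio_ln:
  assumes "3 \<le> n"
  shows "ln (real n) / ln (ln (real n)) - 2 * ln (real n) / (ln (ln (real n)))\<^sup>2 \<le> real (kseq n)"
proof -
  define L where "L = ln (real n)"
  have L: "1 < L" unfolding L_def by (rule ln_gt_1[OF assms])
  have "L / ln L - 2 * L / (ln L)\<^sup>2 \<le> real (kseq n)"
  proof (cases "6 \<le> n")
    case True
    have "L / ln L < real (kseq n) + 1"
      unfolding L_def by (rule ratio_ln_less_kseq[OF True])
    with two_ratio_ln_square_ge_1[OF L] show ?thesis by linarith
  next
    case False
    then have "L \<le> ln 5" unfolding L_def using assms by (intro ln_mono) auto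
    also have "ln 5 \<le> (2 :: real)"
      using ln_le_via_exp[of 5 2 0] by (simp add: power_divide)
    finally have "ln L \<le> 1" using ln_le_minus_one[of L] L by linarith
    moreover have "0 < ln L" using L by simp
    ultimately have "L / ln L \<le> 2 * L / (ln L)\<^sup>2"
      using L by (simp add: field_simps power2_eq_square)
    then show ?thesis by simp
  qed
  then show ?thesis by (simp add: L_def)
qed

theorem theorem4:
  shows "(\<forall>n::nat. n \<ge> 1 \<longrightarrow> mult_one n = n - kseq n)
    \<and> (\<forall>n::nat. n \<ge> 3 \<longrightarrow>
          real n - of_int \<lfloor>1.3841 * ln (real n) / ln (ln (real n))\<rfloor> - 1 \<le> real (mult_one n))
    \<and> (\<forall>n::nat. n \<ge> 6 \<longrightarrow>
          real (mult_one n) \<le> real n - of_int \<lfloor>ln (real n) / ln (ln (real n))\<rfloor>)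
    \<and> (\<forall>n::nat. n \<ge> 3 \<longrightarrow>
          \<bar>real (mult_one n) - real n + ln (real n) / ln (ln (real n))\<bar>
            \<le> 2 * ln (real n) / (ln (ln (real n)))^2)"
proof (intro conjI allI impI)
  fix n :: nat assume "n \<ge> 1"
  then show "mult_one n = n - kseq n" by (rule mult_one_eq)
next
  fix n :: nat assume n: "n \<ge> 3"
  have "real (kseq n) - 1 \<le> 1.3841 * ln (real n) / ln (ln (real n))"
    using kseq_le_ratio_ln[OF n] by simp
  then have "int (kseq n) - 1 \<le> \<lfloor>1.3841 * ln (real n) / ln (ln (real n))\<rfloor>"
    by (simp add: le_floor_iff)
  then have "real (kseq n) - 1 \<le> of_int \<lfloor>1.3841 * ln (real n) / ln (ln (real n))\<rfloor>"
    by linarith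
  then show "real n - of_int \<lfloor>1.3841 * ln (real n) / ln (ln (real n))\<rfloor> - 1 \<le> real (mult_one n)"
    using mult_one_eq[of n] n kseq_le[of n] by (simp add: of_nat_diff)
next
  fix n :: nat assume n: "n \<ge> 6"
  have "ln (real n) / ln (ln (real n)) < real (kseq n) + 1"
    by (rule ratio_ln_less_kseq[OF n])
  \<comment> \<open>The strict bound by the integer \<open>kseq n + 1\<close> is what allows the
    floor to be bounded by \<open>kseq n\<close> itself.\<close>
  then have "\<lfloor>ln (real n) / ln (ln (real n))\<rfloor> < int (kseq n) + 1"
    by linarith
  then have "of_int \<lfloor>ln (real n) / ln (ln (real n))\<rfloor> \<le> real (kseq n)"
    by linarith
  then show "real (mult_one n) \<le> real n - of_int \<lfloor>ln (real n) / ln (ln (real n))\<rfloor>"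
    using mult_one_eq[of n] n kseq_le[of n] by (simp add: of_nat_diff)
next
  fix n :: nat assume n: "n \<ge> 3"
  have "real (mult_one n) - real n = - real (kseq n)"
    using mult_one_eq[of n] n kseq_le[of n] by (simp add: of_nat_diff)
  moreover have "real (kseq n) \<le> ln (real n) / ln (ln (real n)) + 2 * ln (real n) / (ln (ln (real n)))\<^sup>2"
    using kseq_le_ratio_bound[OF n] by (simp add: ratio_bound_def)
  ultimately show "\<bar>real (mult_one n) - real n + ln (real n) / ln (ln (real n))\<bar>
            \<le> 2 * ln (real n) / (ln (ln (real n)))^2"
    using kseq_ge_ratio_ln[OF n] by linarith
qed

end
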